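(* Let $p\ge 0$ be an integer. The error $L_m^{p,+}(t)v=\varphi_p(\sigma tA)v - V_m^+\varphi_p(\sigma tT_m^+)e_1$ of the corrected Krylov approximation to $\varphi_p(\sigma tA)v$ satisfies, as $t\to 0$, $$L_m^{p,+}(t)v=\tau_{m+1,m}\,\gamma_m\,\frac{(\sigma t)^{m+1}}{(m+p+1)!}\,A v_{m+1}+\mathcal{O}(t^{m+2}).$$ Furthermore, in the nonexpansive case $\mu_2(\sigma A)\le 0$, for all $t\ge 0$, $$\|L_m^{p,+}(t)v\|_2\le \|A v_{m+1}\|_2\,\tau_{m+1,m}\,\gamma_m\,\frac{t^{m+1}}{(m+p+1)!},$$ and this bound is asymptotically correct for $t\to 0$, i.e. $\|L_m^{p,+}(t)v\|_2=\|A v_{m+1}\|_2\,\tau_{m+1,m}\,\gamma_m\,\frac{t^{m+1}}{(m+p+1)!}+\mathcal{O}(t^{m+2})$.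
   Context: Setting: $A\in\mathbb{C}^{n\times n}$, $\sigma\in\mathbb{C}$ with $|\sigma|=1$, $v\in\mathbb{C}^n$ with $\|v\|_2=1$, $t\ge 0$ real, and $m\ge 1$ an integer. Krylov decomposition: the Arnoldi iteration (Lanczos if $A$ is Hermitian) applied to $A$ and $v$ is assumed to run until dimension $m$ without breakdown (i.e. $v,Av,\dots,A^m v$ are linearly independent). It yields a matrix $V_m\in\mathbb{C}^{n\times m}$ with $V_m^*V_m=I$ whose columns span $\mathcal{K}_m(A,v)=\mathrm{span}\{v,Av,\dots,A^{m-1}v\}$ and whose first column is $v$ (so $V_me_1=v$), an upper Hessenberg matrix $T_m=V_m^*AV_m\in\mathbb{C}^{m\times m}$ with positive lower diagonal entries $(T_m)_{j+1,j}>0$, a number $\tau_{m+1,m}>0$ and a vector $v_{m+1}\in\mathbb{C}^n$ with $\|v_{m+1}\|_2=1$, $V_m^*v_{m+1}=0$, such that $$A V_m = V_mT_m + \tau_{m+1,m}\,v_{m+1}e_m^*.$$ Here $e_1$ denotes the first unit vector (of $\mathbb{C}^m$ or $\mathbb{C}^{m+1}$, as dimensions require) and $e_m=(0,\dots,0,1)^*\in\mathbb{C}^m$. Notation: $\gamma_m=e_m^*T_m^{m-1}e_1=\prod_{j=1}^{m-1}(T_m)_{j+1,j}$. The $\varphi$-functions are $\varphi_p(z)=\sum_{k=0}^\infty \frac{z^k}{(k+p)!}$ for integers $p\ge 0$ (so $\varphi_0(z)=\mathrm{e}^z$), applied to matrices via the power series. Corrected Krylov approximation: $$T_m^+=\begin{bmatrix}T_m&0\\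 \tau_{m+1,m}e_m^*&0\end{bmatrix}\in\mathbb{C}^{(m+1)\times(m+1)},\qquad V_m^+=[\,V_m\,|\,v_{m+1}\,]\in\mathbb{C}^{n\times(m+1)},$$ and $\varphi_p(\sigma tA)v\approx V_m^+\varphi_p(\sigma tT_m^+)e_1$. Nonexpansive case: $\mu_2(\sigma A)\le 0$, where $\mu_2$ is the logarithmic norm associated with the 2-norm; equivalently the field of values $W(\sigma A)=\{x^*\sigma A x:\|x\|_2=1\}$ is contained in $\mathbb{C}_-=\{z:\mathrm{Re}\,z\le 0\}$. *)

theory Defs
  imports
    "Jordan_Normal_Form.Schur_Decomposition"
    "HOL-Analysis.L2_Norm"
    "HOL-Library.Landau_Symbols"
begin

definition vnorm2 :: "complex vec \<Rightarrow> real" where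
  "vnorm2 x = L2_set (\<lambda>i. cmod (x $ i)) {..<dim_vec x}"

definition opnorm2 :: "complex mat \<Rightarrow> real" where
  "opnorm2 M = (SUP x \<in> {x \<in> carrier_vec (dim_col M). vnorm2 x \<le> 1}. vnorm2 (M *\<^sub>v x))"

definition lognorm2 :: "complex mat \<Rightarrow> real" where
  "lognorm2 M =
     Lim (at_right 0) (\<lambda>h. (opnorm2 (1\<^sub>m (dim_row M) + complex_of_real h \<cdot>\<^sub>m M) - 1) / h)"

text \<open>For a square matrix \<open>M\<close>, \<open>phi_mat p M\<close> is the sum over \<open>k\<close> of \<open>M^k / (k+p)!\<close>. The type of
  matrices of arbitrary dimension carries no topology, so the (always convergent) series is taken
  entry by entry.\<close>

definition phi_mat :: "nat \<Rightarrow> complex mat \<Rightarrow> complex mat" where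
  "phi_mat p M =
     mat (dim_row M) (dim_row M) (\<lambda>(i, j). \<Sum>k. (M ^\<^sub>m k) $$ (i, j) / fact (k + p))"

definition krylov_list :: "complex mat \<Rightarrow> complex vec \<Rightarrow> nat \<Rightarrow> complex vec list" where
  "krylov_list A v k = map (\<lambda>i. (A ^\<^sub>m i) *\<^sub>v v) [0..<k]"

definition upper_hessenberg :: "complex mat \<Rightarrow> bool" where
  "upper_hessenberg T \<longleftrightarrow> (\<forall>i < dim_row T. \<forall>j < dim_col T. j + 1 < i \<longrightarrow> T $$ (i, j) = 0)"

text \<open>The result of \<open>m\<close> steps of the Arnoldi iteration without breakdown. Indices start at 0, so
  \<open>e_1\<close> is \<open>unit_vec m 0\<close> and \<open>e_m\<close> is \<open>unit_vec m (m - 1)\<close>. The order on complex numbers is the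
  one in which \<open>0 < z\<close> means that \<open>z\<close> is a positive real number.\<close>

locale krylov_decomposition =
  fixes n m :: nat and A :: "complex mat" and v :: "complex vec"
    and V T :: "complex mat" and \<tau> :: real and w :: "complex vec"
  assumes no_breakdown_distinct: "distinct (krylov_list A v (m + 1))"
    and no_breakdown_indpt:
      "\<not> module.lin_dep class_ring (module_vec TYPE(complex) n) (set (krylov_list A v (m + 1)))"
    and V_carrier: "V \<in> carrier_mat n m"
    and V_orthonormal: "mat_adjoint V * V = 1\<^sub>m m"
    and V_span:
      "LinearCombinations.module.span class_ring (module_vec TYPE(complex) n) (set (cols V)) =
       LinearCombinations.module.span class_ring (module_vec TYPE(complex) n)
         (set (krylov_list A v m))"
    and V_first: "V *\<^sub>v unit_vec m 0 = v"
    and T_carrier: "T \<in> carrier_mat m m"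
    and T_def: "T = mat_adjoint V * A * V"
    and T_hessenberg: "upper_hessenberg T"
    and T_subdiag_pos: "\<And>j. j + 1 < m \<Longrightarrow> 0 < T $$ (j + 1, j)"
    and tau_pos: "0 < \<tau>"
    and w_carrier: "w \<in> carrier_vec n"
    and w_norm: "vnorm2 w = 1"
    and w_orthogonal: "mat_adjoint V *\<^sub>v w = 0\<^sub>v m"
    and recurrence:
      "A * V = V * T + complex_of_real \<tau> \<cdot>\<^sub>m
         (mat_of_cols n [w] * mat_of_rows m [unit_vec m (m - 1)])"

definition krylov_gamma :: "complex mat \<Rightarrow> complex" where
  "krylov_gamma T =
     (let m = dim_row T
      in unit_vec m (m - 1) \<bullet> ((T ^\<^sub>m (m - 1)) *\<^sub>v unit_vec m 0))"

definition T_plus :: "complex mat \<Rightarrow> real \<Rightarrow> complex mat" where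
  "T_plus T \<tau> =
     (let m = dim_row T
      in four_block_mat T (0\<^sub>m m 1)
           (mat_of_rows m [complex_of_real \<tau> \<cdot>\<^sub>v unit_vec m (m - 1)]) (0\<^sub>m 1 1))"

definition V_plus :: "complex mat \<Rightarrow> complex vec \<Rightarrow> complex mat" where
  "V_plus V w = mat_of_cols (dim_row V) (cols V @ [w])"

definition corrected_krylov_error ::
  "nat \<Rightarrow> complex \<Rightarrow> complex mat \<Rightarrow> complex vec \<Rightarrow> complex mat \<Rightarrow> complex mat \<Rightarrow> real \<Rightarrow> complex vec
     \<Rightarrow> real \<Rightarrow> complex vec" where
  "corrected_krylov_error p \<sigma> A v V T \<tau> w t =
     phi_mat p ((\<sigma> * complex_of_real t) \<cdot>\<^sub>m A) *\<^sub>v v -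
     V_plus V w *\<^sub>v
       (phi_mat p ((\<sigma> * complex_of_real t) \<cdot>\<^sub>m T_plus T \<tau>) *\<^sub>v unit_vec (dim_row T + 1) 0)"

text \<open>For an upper Hessenberg matrix, \<open>krylov_gamma T\<close> is the product of the subdiagonal entries.
  In a Krylov decomposition it is therefore a positive real number, and \<open>Re (krylov_gamma T)\<close> is
  that number as an element of type \<open>real\<close>.\<close>

lemma upper_hessenberg_pow_first_column:
  assumes T: "T \<in> carrier_mat m m" and H: "upper_hessenberg T" and "0 < m"
  shows "k < m \<Longrightarrow>
    (\<forall>i < m. k < i \<longrightarrow> ((T ^\<^sub>m k) *\<^sub>v unit_vec m 0) $ i = 0) \<and>
    ((T ^\<^sub>m k) *\<^sub>v unit_vec m 0) $ k = (\<Prod>j<k. T $$ (j + 1, j))"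
proof (induction k)
  case 0
  then show ?case using T by auto
next
  case (Suc k)
  define x where "x = (T ^\<^sub>m k) *\<^sub>v unit_vec m 0"
  have x: "x \<in> carrier_vec m" unfolding x_def using T by (intro mult_mat_vec_carrier[of _ m m]) auto
  have IH: "\<And>i. i < m \<Longrightarrow> k < i \<Longrightarrow> x $ i = 0" "x $ k = (\<Prod>j<k. T $$ (j + 1, j))"
    using Suc unfolding x_def by auto
  have comm: "T ^\<^sub>m Suc k = T * T ^\<^sub>m k"
  proof (induction k)
    case 0
    then show ?case using T by simp
  next
    case (Suc k)
    then have "T ^\<^sub>m Suc (Suc k) = (T * T ^\<^sub>m k) * T" by simp
    also have "\<dots> = T * (T ^\<^sub>m k * T)"
      using T by (intro assoc_mult_mat[of _ m m _ m _ m]) auto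
    finally show ?case by simp
  qed
  have step: "(T ^\<^sub>m Suc k) *\<^sub>v unit_vec m 0 = T *\<^sub>v x"
    unfolding comm x_def using T by (intro assoc_mult_mat_vec) auto
  have entry: "(T *\<^sub>v x) $ i = (\<Sum>j<m. T $$ (i, j) * x $ j)" if "i < m" for i
    using that T x by (simp add: scalar_prod_def lessThan_atLeast0)
  have zero: "T $$ (i, j) * x $ j = 0" if "i < m" "j < m" "Suc k \<le> i" "\<not> (i = Suc k \<and> j = k)" for i j
  proof (cases "k < j")
    case True
    then show ?thesis using IH(1) that by simp
  next
    case False
    then have "j + 1 < i" using that by linarith
    then show ?thesis using H T that unfolding upper_hessenberg_def by auto
  qed
  have "(T *\<^sub>v x) $ i = 0" if "i < m" "Suc k < i" for i
    unfolding entry[OF that(1)] using that zero by (intro sum.neutral) auto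
  moreover have "(T *\<^sub>v x) $ Suc k = (\<Prod>j<Suc k. T $$ (j + 1, j))"
  proof -
    have "(\<Sum>j<m. T $$ (Suc k, j) * x $ j) = (\<Sum>j\<in>{k}. T $$ (Suc k, j) * x $ j)"
      using Suc.prems zero by (intro sum.mono_neutral_right) auto
    then show ?thesis using entry[OF Suc.prems] IH(2) by simp
  qed
  ultimately show ?case unfolding step by blast
qed

lemma krylov_gamma_eq_prod:
  assumes T: "T \<in> carrier_mat m m" and "upper_hessenberg T" and m: "0 < m"
  shows "krylov_gamma T = (\<Prod>j<m - 1. T $$ (j + 1, j))"
proof -
  have "(T ^\<^sub>m (m - 1)) *\<^sub>v unit_vec m 0 \<in> carrier_vec m"
    using T by (intro mult_mat_vec_carrier[of _ m m]) auto
  then have "krylov_gamma T = ((T ^\<^sub>m (m - 1)) *\<^sub>v unit_vec m 0) $ (m - 1)"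
    unfolding krylov_gamma_def Let_def using T m by (simp add: scalar_prod_left_unit)
  then show ?thesis
    using upper_hessenberg_pow_first_column[OF assms, of "m - 1"] m by simp
qed

lemma (in krylov_decomposition) krylov_gamma_pos:
  assumes "0 < m"
  shows "0 < krylov_gamma T"
  unfolding krylov_gamma_eq_prod[OF T_carrier T_hessenberg assms]
proof -
  have "0 < (\<Prod>j<k. T $$ (j + 1, j))" if "k < m" for k
    using that
  proof (induction k)
    case (Suc k)
    then show ?case using T_subdiag_pos[of k] by (auto simp: less_complex_def)
  qed (simp add: less_complex_def)
  then show "0 < (\<Prod>j<m - 1. T $$ (j + 1, j))" using assms by simp
qed

end

theory Submission
  imports Defs
begin

text \<open>
  Put \<open>M = \<sigma> A\<close>. The error is a power series in \<open>t\<close> with vector coefficients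
  \<open>\<epsilon>\<^sub>k / (k + p)!\<close>, where \<open>\<epsilon>\<^sub>k = M\<^sup>k v - V\<^sup>+ (\<sigma> T\<^sup>+)\<^sup>k e\<^sub>1\<close>. The Krylov recurrence
  says that \<open>\<epsilon>\<^sub>0 = 0\<close> and \<open>\<epsilon>\<^sub>k\<^sub>+\<^sub>1 = M \<epsilon>\<^sub>k + s\<^sub>k M v\<^sub>m\<^sub>+\<^sub>1\<close>, where \<open>s\<^sub>k\<close> is the last
  component of \<open>(\<sigma> T\<^sup>+)\<^sup>k e\<^sub>1\<close> (\<open>err_coeff_Suc\<close>). Because \<open>T\<close> is upper Hessenberg, powers
  of \<open>T\<close> move \<open>e\<^sub>1\<close> down by at most one component at a time, so \<open>s\<^sub>k = 0\<close> for \<open>k < m\<close> and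
  \<open>s\<^sub>m = \<sigma>\<^sup>m \<tau> \<gamma>\<close>. Hence \<open>\<epsilon>\<^sub>k\<close> vanishes for \<open>k \<le> m\<close>, its value at \<open>k = m + 1\<close> is the
  asserted leading coefficient, and the expansion for \<open>t \<rightarrow> 0\<close> is a statement about the
  remainder of a power series.

  For the bound, multiply the error by \<open>t\<^sup>p\<close>. The coefficients of \<open>t\<^sup>k\<^sup>+\<^sup>p / (k + p)!\<close> are then the
  \<open>\<epsilon>\<^sub>k\<close> themselves: for every \<open>p\<close> the result is an exponential generating function, and the
  recurrence turns into the differential equation \<open>E' = M E + S M v\<^sub>m\<^sub>+\<^sub>1\<close>, \<open>E(0) = 0\<close>, with a scalar
  function \<open>S\<close> built from \<open>s\<close> in the same way. A non-positive logarithmic norm places the field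
  of values of \<open>M\<close> in the left half plane, so \<open>M\<close> cannot increase the norm of a solution, and
  \<open>\<parallel>E\<parallel>' \<le> \<bar>S\<bar> \<parallel>M v\<^sub>m\<^sub>+\<^sub>1\<parallel>\<close> (\<open>dissipative_ode_bound\<close>).

  It remains to prove \<open>\<bar>S(t)\<bar> \<le> \<tau> \<gamma> t\<^sup>m\<^sup>+\<^sup>p / (m + p)!\<close>. By the Schur form,
  the sequence \<open>e\<^sub>m\<^sup>* (\<sigma> T)\<^sup>k e\<^sub>1\<close> is annihilated by the product of the operators
  \<open>(shift - \<lambda>)\<close> over the \<open>m\<close> eigenvalues of \<open>\<sigma> T\<close>; these lie in the left half plane since
  \<open>\<sigma> T\<close> is a compression of \<open>M\<close>. Each of the \<open>p + 1\<close> index shifts that lead from this sequence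
  to \<open>S\<close> contributes a further root 0. One factor \<open>(shift - \<lambda>)\<close> is one scalar equation
  \<open>f' = \<lambda> f + g\<close> with \<open>Re \<lambda> \<le> 0\<close>, that is, at most one integration of the bound; since the initial
  values vanish as long as factors remain, induction on the number of roots gives the power of
  \<open>t\<close> and the factorial (\<open>phi_series_0_bound\<close>). This induction takes the place of the usual
  estimate of divided differences of the exponential function.
\<close>

section \<open>Power series with factorial denominators\<close>

text \<open>
  Geometric growth is the growth of matrix powers. It makes every series below converge on all of
  the complex plane, and it is preserved by all operations on sequences that are used.
\<close>

definition geometrically_bounded :: "(nat \<Rightarrow> complex) \<Rightarrow> bool" where
  "geometrically_bounded a \<longleftrightarrow> (\<exists>C R. \<forall>k. cmod (a k) \<le> C * R ^ k)"

text \<open>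
  If \<open>a k\<close> is an entry of \<open>M\<^sup>k\<close>, this is the corresponding entry of \<open>\<phi>\<^sub>p(z M)\<close>. The case \<open>p = 0\<close> is
  the exponential generating function of \<open>a\<close>.
\<close>

definition phi_series :: "nat \<Rightarrow> (nat \<Rightarrow> complex) \<Rightarrow> complex \<Rightarrow> complex" where
  "phi_series p a z = (\<Sum>k. a k * z ^ k / fact (k + p))"

definition shift :: "nat \<Rightarrow> (nat \<Rightarrow> complex) \<Rightarrow> nat \<Rightarrow> complex" where
  "shift p a k = (if k < p then 0 else a (k - p))"

lemma geometrically_boundedE:
  assumes "geometrically_bounded a"
  obtains C R where "0 \<le> C" "1 \<le> R" "\<And>k. cmod (a k) \<le> C * R ^ k"
proof -
  obtain C R where *: "\<And>k. cmod (a k) \<le> C * R ^ k"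
    using assms unfolding geometrically_bounded_def by blast
  have C: "0 \<le> C" using *[of 0] norm_ge_zero[of "a 0"] by (simp del: norm_ge_zero)
  have "cmod (a k) \<le> C * (max 1 \<bar>R\<bar>) ^ k" for k
  proof -
    have "R ^ k \<le> \<bar>R\<bar> ^ k" by (metis abs_ge_self power_abs)
    also have "\<dots> \<le> (max 1 \<bar>R\<bar>) ^ k" by (intro power_mono) auto
    finally show ?thesis using *[of k] C by (meson mult_left_mono order_trans)
  qed
  then show ?thesis using that[of C "max 1 \<bar>R\<bar>"] C by auto
qed

lemma geometrically_bounded_zero: "geometrically_bounded (\<lambda>k. 0)"
  unfolding geometrically_bounded_def by (intro exI[of _ 0]) simp

lemma geometrically_bounded_add:
  assumes "geometrically_bounded a" "geometrically_bounded b"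
  shows "geometrically_bounded (\<lambda>k. a k + b k)"
proof -
  obtain C R where 1: "0 \<le> C" "1 \<le> R" "\<And>k. cmod (a k) \<le> C * R ^ k"
    using geometrically_boundedE[OF assms(1)] by blast
  obtain D S where 2: "0 \<le> D" "1 \<le> S" "\<And>k. cmod (b k) \<le> D * S ^ k"
    using geometrically_boundedE[OF assms(2)] by blast
  have "cmod (a k + b k) \<le> (C + D) * (max R S) ^ k" for k
  proof -
    have "C * R ^ k \<le> C * (max R S) ^ k" "D * S ^ k \<le> D * (max R S) ^ k"
      using 1 2 by (auto intro!: mult_left_mono power_mono)
    then show ?thesis
      using norm_triangle_ineq[of "a k" "b k"] 1(3)[of k] 2(3)[of k] by (simp add: distrib_right)
  qed
  then show ?thesis unfolding geometrically_bounded_def by blast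
qed

lemma geometrically_bounded_cmult:
  assumes "geometrically_bounded a"
  shows "geometrically_bounded (\<lambda>k. c * a k)"
proof -
  obtain C R where "\<And>k. cmod (a k) \<le> C * R ^ k"
    using assms unfolding geometrically_bounded_def by blast
  then have "cmod (c * a k) \<le> (cmod c * C) * R ^ k" for k
    by (simp add: norm_mult mult.assoc mult_left_mono)
  then show ?thesis unfolding geometrically_bounded_def by blast
qed

lemma geometrically_bounded_diff:
  "geometrically_bounded a \<Longrightarrow> geometrically_bounded b \<Longrightarrow> geometrically_bounded (\<lambda>k. a k - b k)"
  using geometrically_bounded_add[of a "\<lambda>k. (-1) * b k"] geometrically_bounded_cmult[of b "-1"]
  by simp

lemma geometrically_bounded_sum:
  "(\<And>i. i \<in> I \<Longrightarrow> geometrically_bounded (a i)) \<Longrightarrow> geometrically_bounded (\<lambda>k. \<Sum>i\<in>I. a i k)"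
  by (induction I rule: infinite_finite_induct)
    (simp_all add: geometrically_bounded_zero geometrically_bounded_add)

lemma geometrically_bounded_Suc:
  assumes "geometrically_bounded a"
  shows "geometrically_bounded (\<lambda>k. a (Suc k))"
proof -
  obtain C R where *: "\<And>k. cmod (a k) \<le> C * R ^ k"
    using assms unfolding geometrically_bounded_def by blast
  have "cmod (a (Suc k)) \<le> (C * R) * R ^ k" for k using *[of "Suc k"] by (simp add: mult_ac)
  then show ?thesis unfolding geometrically_bounded_def by blast
qed

lemma geometrically_bounded_shift:
  assumes "geometrically_bounded a"
  shows "geometrically_bounded (shift p a)"
proof -
  obtain C R where 1: "0 \<le> C" "1 \<le> R" "\<And>k. cmod (a k) \<le> C * R ^ k"
    using geometrically_boundedE[OF assms(1)] by blast
  have "cmod (shift p a k) \<le> C * R ^ k" for k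
  proof -
    have "C * R ^ (k - p) \<le> C * R ^ k"
      using 1 by (intro mult_left_mono power_increasing) auto
    then show ?thesis using 1(1,2) 1(3)[of "k - p"] by (auto simp: shift_def)
  qed
  then show ?thesis unfolding geometrically_bounded_def by blast
qed

lemma summable_norm_phi_series:
  assumes "geometrically_bounded a"
  shows "summable (\<lambda>k. norm (a k * z ^ k / fact (k + p)))"
proof -
  obtain C R where 1: "0 \<le> C" "1 \<le> R" "\<And>k. cmod (a k) \<le> C * R ^ k"
    using geometrically_boundedE[OF assms(1)] by blast
  have "summable (\<lambda>k. C * (inverse (fact k) * (R * cmod z) ^ k))"
    by (intro summable_mult summable_exp)
  then show ?thesis
  proof (rule summable_comparison_test')
    fix k
    have "cmod (a k) * cmod z ^ k / fact (k + p) \<le> (C * R ^ k) * cmod z ^ k / fact k"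
      using 1 by (intro frac_le mult_right_mono fact_mono mult_nonneg_nonneg) auto
    then show "norm (norm (a k * z ^ k / fact (k + p))) \<le> C * (inverse (fact k) * (R * cmod z) ^ k)"
      by (simp add: norm_mult norm_divide norm_power power_mult_distrib field_simps)
  qed
qed

lemma summable_phi_series:
  "geometrically_bounded a \<Longrightarrow> summable (\<lambda>k. a k * z ^ k / fact (k + p))"
  by (rule summable_norm_cancel[OF summable_norm_phi_series])

lemma phi_series_add:
  assumes "geometrically_bounded a" "geometrically_bounded b"
  shows "phi_series p (\<lambda>k. a k + b k) z = phi_series p a z + phi_series p b z"
  unfolding phi_series_def
  using suminf_add[OF summable_phi_series[OF assms(1)] summable_phi_series[OF assms(2)], of z p z p]
  by (simp add: add_divide_distrib distrib_right)

lemma phi_series_cmult: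
  assumes "geometrically_bounded a"
  shows "phi_series p (\<lambda>k. c * a k) z = c * phi_series p a z"
  unfolding phi_series_def
  using suminf_mult[OF summable_phi_series[OF assms], of c z p]
  by (simp add: mult.assoc)

lemma phi_series_zero: "phi_series p (\<lambda>k. 0) z = 0"
  by (simp add: phi_series_def)

lemma phi_series_diff:
  assumes "geometrically_bounded a" "geometrically_bounded b"
  shows "phi_series p (\<lambda>k. a k - b k) z = phi_series p a z - phi_series p b z"
  using phi_series_add[OF assms(1) geometrically_bounded_cmult[OF assms(2), of "-1"]]
    phi_series_cmult[OF assms(2), of _ "-1"] by simp

lemma phi_series_sum:
  assumes "\<And>i. i \<in> I \<Longrightarrow> geometrically_bounded (a i)"
  shows "phi_series p (\<lambda>k. \<Sum>i\<in>I. a i k) z = (\<Sum>i\<in>I. phi_series p (a i) z)"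
  using assms
  by (induction I rule: infinite_finite_induct)
    (simp_all add: phi_series_zero phi_series_add geometrically_bounded_sum)

lemma phi_series_at_0: "phi_series p a 0 = a 0 / fact p"
proof -
  have "(\<lambda>k. a k * 0 ^ k / fact (k + p)) = (\<lambda>k. if k = 0 then a k / fact (k + p) else 0)" by auto
  then show ?thesis
    unfolding phi_series_def using sums_single[of 0 "\<lambda>k. a k / fact (k + p)"] by (simp add: sums_iff)
qed

text \<open>
  This reduces general \<open>p\<close> to exponential generating functions, whose derivative is a mere shift
  of the index.
\<close>

lemma phi_series_0_shift:
  assumes "geometrically_bounded a"
  shows "phi_series 0 (shift p a) z = z ^ p * phi_series p a z"
proof -
  have "(\<lambda>k. shift p a (k + p) * z ^ (k + p) / fact (k + p)) sums (z ^ p * phi_series p a z)"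
    using sums_mult[OF summable_sums[OF summable_phi_series[OF assms, of z p]], of "z ^ p"]
    by (simp add: shift_def power_add phi_series_def mult_ac)
  moreover have "(\<Sum>k<p. shift p a k * z ^ k / fact k) = 0"
    by (intro sum.neutral) (simp add: shift_def)
  ultimately have "(\<lambda>k. shift p a k * z ^ k / fact k) sums (z ^ p * phi_series p a z)"
    using sums_iff_shift'[of "\<lambda>k. shift p a k * z ^ k / fact k" p "z ^ p * phi_series p a z"] by simp
  then show ?thesis unfolding phi_series_def by (simp add: sums_iff)
qed

lemma phi_series_0_deriv:
  assumes "geometrically_bounded a"
  shows "((\<lambda>t::real. phi_series 0 a (of_real t)) has_vector_derivative
           phi_series 0 (\<lambda>k. a (Suc k)) (of_real t)) (at t)"
proof -
  have *: "(\<lambda>k. a k * z ^ k / fact (k + 0)) = (\<lambda>k. a k / fact k * z ^ k)" for a and z :: complex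
    by (intro ext) simp
  have d: "diffs (\<lambda>k. a k / fact k) = (\<lambda>k. a (Suc k) / fact k)"
    by (auto simp: diffs_def divide_simps simp del: of_nat_Suc)
  have "((\<lambda>z. phi_series 0 a z) has_field_derivative phi_series 0 (\<lambda>k. a (Suc k)) z) (at z)" for z
    using termdiffs_strong_converges_everywhere[of "\<lambda>k. a k / fact k" z]
      summable_phi_series[OF assms, of _ 0]
    unfolding phi_series_def * d by blast
  then have "(phi_series 0 a has_derivative (*) (phi_series 0 (\<lambda>k. a (Suc k)) (of_real t)))
       (at (of_real t))"
    unfolding has_field_derivative_def .
  then show ?thesis
    unfolding has_vector_derivative_def
    using has_derivative_compose[OF has_derivative_of_real[OF has_derivative_ident[of "at t"]]]
    by (fastforce simp: scaleR_conv_of_real mult.commute)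
qed

lemma phi_series_remainder:
  assumes a: "geometrically_bounded a" and z: "\<And>k. k < q \<Longrightarrow> a k = 0"
  shows "(\<lambda>t::real. cmod (phi_series p a (of_real t) - a q * of_real t ^ q / fact (q + p)))
     \<in> O[at_right 0](\<lambda>t. t ^ Suc q)"
proof -
  define B where "B = (\<Sum>k. norm (a (k + Suc q) / fact (k + Suc q + p)))"
  have sB: "summable (\<lambda>k. norm (a (k + Suc q) / fact (k + Suc q + p)))"
    using summable_norm_phi_series[OF a, of 1 p]
    by (subst summable_iff_shift[of "\<lambda>k. norm (a k / fact (k + p))"]) simp
  have "norm (phi_series p a (of_real t) - a q * of_real t ^ q / fact (q + p))
     \<le> B * t ^ Suc q" if t: "0 < t" "t < 1" for t
  proof -
    let ?f = "\<lambda>k. a k * complex_of_real t ^ k / fact (k + p)"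
    have "phi_series p a (of_real t) = (\<Sum>k. ?f (k + Suc q)) + (\<Sum>k<Suc q. ?f k)"
      unfolding phi_series_def by (rule suminf_split_initial_segment[OF summable_phi_series[OF a]])
    moreover have "(\<Sum>k<Suc q. ?f k) = ?f q" using z by simp
    ultimately have eq: "phi_series p a (of_real t) - ?f q = (\<Sum>k. ?f (k + Suc q))" by simp
    have "norm (\<Sum>k. ?f (k + Suc q))
        \<le> (\<Sum>k. norm (a (k + Suc q) / fact (k + Suc q + p)) * t ^ Suc q)"
    proof (rule norm_suminf_le)
      show "summable (\<lambda>k. norm (a (k + Suc q) / fact (k + Suc q + p)) * t ^ Suc q)"
        using sB by (rule summable_mult2)
      fix k
      have "t ^ (k + Suc q) \<le> t ^ Suc q" using t by (intro power_decreasing) auto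
      then have "norm (a (k + Suc q)) / fact (k + Suc q + p) * t ^ (k + Suc q)
           \<le> norm (a (k + Suc q)) / fact (k + Suc q + p) * t ^ Suc q"
        by (intro mult_left_mono) auto
      then show "norm (?f (k + Suc q)) \<le> norm (a (k + Suc q) / fact (k + Suc q + p)) * t ^ Suc q"
        using t by (simp add: norm_mult norm_divide norm_power del: power_Suc fact_Suc)
    qed
    also have "\<dots> = B * t ^ Suc q" unfolding B_def using sB by (rule suminf_mult2[symmetric])
    finally show ?thesis unfolding eq .
  qed
  then show ?thesis
    by (intro bigoI[where c = B]) (auto simp: eventually_at_right[of 0 1] intro!: exI[of _ 1])
qed

section \<open>Growth of solutions of dissipative differential equations\<close>

text \<open>
  If \<open>N\<close> is a squared norm, the hypothesis says \<open>(\<surd>N)' \<le> G'\<close> wherever \<open>\<surd>N\<close> is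
  differentiable. At zeros of \<open>N\<close> it need not be; the proof therefore compares \<open>G\<close> with the smooth
  function \<open>\<surd>(N + d\<^sup>2)\<close>, which obeys the same differential inequality, and lets \<open>d\<close> tend
  to 0.
\<close>

lemma sqrt_growth_bound:
  fixes N N' G G' :: "real \<Rightarrow> real"
  assumes N: "\<And>t. (N has_real_derivative N' t) (at t)"
    and G: "\<And>t. (G has_real_derivative G' t) (at t)"
    and N0: "\<And>t. 0 \<le> N t" and G'0: "\<And>t. 0 \<le> t \<Longrightarrow> 0 \<le> G' t"
    and le: "\<And>t. 0 \<le> t \<Longrightarrow> N' t \<le> 2 * sqrt (N t) * G' t"
    and init: "sqrt (N 0) \<le> G 0" and t: "0 \<le> t"
  shows "sqrt (N t) \<le> G t"
proof (rule field_le_epsilon)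
  fix d :: real assume d: "0 < d"
  define h where "h s = sqrt (N s + d\<^sup>2) - G s" for s
  have pos: "0 < N s + d\<^sup>2" for s using N0[of s] d by (simp add: add_nonneg_pos)
  have "\<exists>y. (h has_real_derivative y) (at s) \<and> y \<le> 0" if "0 \<le> s" for s
  proof (intro exI conjI)
    show "(h has_real_derivative (N' s * (inverse (sqrt (N s + d\<^sup>2)) / 2) - G' s)) (at s)"
      unfolding h_def using pos[of s]
      by (auto intro!: derivative_eq_intros N G simp: field_simps)
    have "N' s \<le> 2 * sqrt (N s + d\<^sup>2) * G' s"
      using le[OF that] mult_right_mono[OF _ G'0[OF that], of "2 * sqrt (N s)" "2 * sqrt (N s + d\<^sup>2)"]
      by simp
    then show "N' s * (inverse (sqrt (N s + d\<^sup>2)) / 2) - G' s \<le> 0"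
      using pos[of s] by (simp add: field_simps)
  qed
  then have "h t \<le> h 0" using t by (intro DERIV_nonpos_imp_nonincreasing[of 0 t h]) auto
  moreover have "sqrt (N 0 + d\<^sup>2) \<le> sqrt (N 0) + d"
    using sqrt_add_le_add_sqrt[of "N 0" "d\<^sup>2"] N0 d by simp
  moreover have "sqrt (N t) \<le> sqrt (N t + d\<^sup>2)" by simp
  ultimately show "sqrt (N t) \<le> G t + d" using init unfolding h_def by linarith
qed

text \<open>
  The field of values lies in the closed left half plane.
\<close>

definition dissipative :: "complex mat \<Rightarrow> bool" where
  "dissipative M \<longleftrightarrow> (\<forall>x \<in> carrier_vec (dim_row M). Re ((M *\<^sub>v x) \<bullet>c x) \<le> 0)"

lemma vnorm2_nonneg: "0 \<le> vnorm2 x"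
  by (simp add: vnorm2_def)

lemma vnorm2_eq_sqrt: "vnorm2 x = sqrt (Re (x \<bullet>c x))"
  unfolding vnorm2_def L2_set_def scalar_prod_def
  by (simp add: Re_sum cmod_power2 lessThan_atLeast0 flip: power2_eq_square)

lemma vnorm2_squared: "(vnorm2 x)\<^sup>2 = Re (x \<bullet>c x)"
  unfolding vnorm2_def L2_set_def scalar_prod_def
  by (simp add: Re_sum cmod_power2 lessThan_atLeast0 sum_nonneg flip: power2_eq_square)

lemma vnorm2_smult: "vnorm2 (c \<cdot>\<^sub>v x) = cmod c * vnorm2 x"
  unfolding vnorm2_def L2_set_right_distrib[OF norm_ge_zero]
  by (intro L2_set_cong) (auto simp: norm_mult)

lemma vnorm2_add_le:
  assumes "dim_vec x = dim_vec y"
  shows "vnorm2 (x + y) \<le> vnorm2 x + vnorm2 y"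
proof -
  have "vnorm2 (x + y) \<le> L2_set (\<lambda>i. cmod (x $ i) + cmod (y $ i)) {..<dim_vec y}"
    unfolding vnorm2_def using assms by (auto intro!: L2_set_mono norm_triangle_ineq)
  also have "\<dots> \<le> vnorm2 x + vnorm2 y"
    unfolding vnorm2_def assms by (rule L2_set_triangle_ineq)
  finally show ?thesis .
qed

lemma vnorm2_diff_ge:
  assumes "dim_vec x = dim_vec y"
  shows "\<bar>vnorm2 x - vnorm2 y\<bar> \<le> vnorm2 (x - y)"
proof -
  have "x = (x - y) + y" "y = (-1) \<cdot>\<^sub>v (x - y) + x"
    using assms by (auto intro!: eq_vecI)
  then have "vnorm2 x \<le> vnorm2 (x - y) + vnorm2 y" "vnorm2 y \<le> vnorm2 (x - y) + vnorm2 x"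
    using vnorm2_add_le[of "x - y" y] vnorm2_add_le[of "(-1) \<cdot>\<^sub>v (x - y)" x] assms
    by (auto simp: vnorm2_smult)
  then show ?thesis by linarith
qed

lemma Re_cscalar_prod_le:
  assumes "dim_vec x = dim_vec y"
  shows "Re (x \<bullet>c y) \<le> vnorm2 x * vnorm2 y"
proof -
  have "Re (x \<bullet>c y) \<le> cmod (x \<bullet>c y)" by (rule complex_Re_le_cmod)
  also have "\<dots> \<le> (\<Sum>i<dim_vec y. \<bar>cmod (x $ i)\<bar> * \<bar>cmod (y $ i)\<bar>)"
    unfolding scalar_prod_def
    by (auto intro!: order_trans[OF norm_sum] simp: norm_mult lessThan_atLeast0)
  also have "\<dots> \<le> vnorm2 x * vnorm2 y"
    unfolding vnorm2_def assms by (rule L2_set_mult_ineq)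
  finally show ?thesis .
qed

text \<open>
  In \<open>(\<parallel>y\<parallel>\<^sup>2)' = 2 Re \<langle>M y, y\<rangle> + 2 Re \<langle>b, y\<rangle>\<close> the first term is not positive, and the second
  one is at most \<open>2 \<parallel>b\<parallel> \<parallel>y\<parallel>\<close>. This replaces the variation-of-constants formula together with
  \<open>\<parallel>exp(t M)\<parallel> \<le> 1\<close>.
\<close>

lemma dissipative_ode_bound:
  fixes y b :: "real \<Rightarrow> complex vec"
  assumes M: "M \<in> carrier_mat n n" "dissipative M"
    and y: "\<And>t. y t \<in> carrier_vec n" and b: "\<And>t. b t \<in> carrier_vec n"
    and ode: "\<And>t i. i < n \<Longrightarrow>
      ((\<lambda>t. y t $ i) has_vector_derivative (M *\<^sub>v y t + b t) $ i) (at t)"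
    and G: "\<And>t. (G has_real_derivative G' t) (at t)"
    and le: "\<And>t. 0 \<le> t \<Longrightarrow> vnorm2 (b t) \<le> G' t"
    and init: "vnorm2 (y 0) \<le> G 0" and t: "0 \<le> t"
  shows "vnorm2 (y t) \<le> G t"
proof -
  define N where "N t = (vnorm2 (y t))\<^sup>2" for t
  define N' where "N' t = 2 * Re ((M *\<^sub>v y t + b t) \<bullet>c y t)" for t
  have sqrtN: "sqrt (N t) = vnorm2 (y t)" for t by (simp add: N_def vnorm2_nonneg)
  have dim: "dim_vec (y t) = n" "dim_vec (b t) = n" "dim_row M = n" for t
    using y b M by auto
  have "(N has_real_derivative N' t) (at t)" for t
  proof -
    let ?d = "\<lambda>i. (M *\<^sub>v y t + b t) $ i"
    have N_sum: "N = (\<lambda>t. \<Sum>i<n. (Re (y t $ i))\<^sup>2 + (Im (y t $ i))\<^sup>2)"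
      unfolding N_def vnorm2_def L2_set_def dim by (simp add: sum_nonneg cmod_power2)
    have N'_sum: "N' t = (\<Sum>i<n. 2 * Re (y t $ i) * Re (?d i) + 2 * Im (y t $ i) * Im (?d i))"
      unfolding N'_def scalar_prod_def
      by (simp add: dim Re_sum lessThan_atLeast0 sum_distrib_left algebra_simps del: index_mult_mat_vec)
    have "((\<lambda>t. Re (y t $ i)) has_real_derivative Re (?d i)) (at t)"
      "((\<lambda>t. Im (y t $ i)) has_real_derivative Im (?d i)) (at t)" if "i < n" for i
      using bounded_linear.has_vector_derivative[OF bounded_linear_Re ode[OF that]]
        bounded_linear.has_vector_derivative[OF bounded_linear_Im ode[OF that]]
      by (simp_all add: has_real_derivative_iff_has_vector_derivative)
    moreover have "((\<lambda>s. (f s)\<^sup>2) has_real_derivative 2 * f t * f') (at t)"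
      if "(f has_real_derivative f') (at t)" for f f'
      using DERIV_power[OF that, of 2] by (simp add: mult_ac)
    ultimately show ?thesis
      unfolding N_sum N'_sum
      by (intro DERIV_sum DERIV_add) auto
  qed
  moreover have "N' t \<le> 2 * sqrt (N t) * G' t" if "0 \<le> t" for t
  proof -
    have "(M *\<^sub>v y t + b t) \<bullet>c y t = (M *\<^sub>v y t) \<bullet>c y t + b t \<bullet>c y t"
      by (rule add_scalar_prod_distrib[of _ n]) (use y b M in auto)
    moreover have "Re ((M *\<^sub>v y t) \<bullet>c y t) \<le> 0"
      using M y unfolding dissipative_def by auto
    moreover have "Re (b t \<bullet>c y t) \<le> vnorm2 (b t) * vnorm2 (y t)"
      by (rule Re_cscalar_prod_le) (simp add: dim)
    moreover have "vnorm2 (b t) * vnorm2 (y t) \<le> G' t * vnorm2 (y t)"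
      by (rule mult_right_mono[OF le[OF that] vnorm2_nonneg])
    ultimately show ?thesis unfolding N'_def sqrtN by (simp add: mult.commute)
  qed
  moreover have "0 \<le> G' t" if "0 \<le> t" for t using le[OF that] vnorm2_nonneg order_trans by blast
  ultimately have "sqrt (N t) \<le> G t"
    using init G t by (intro sqrt_growth_bound[of N N' G G' t]) (auto simp: sqrtN N_def vnorm2_nonneg)
  then show ?thesis unfolding sqrtN .
qed

section \<open>Linear recurrences with roots in the left half plane\<close>

text \<open>
  With \<open>S\<close> the shift operator on sequences, this says that \<open>(S - \<lambda>\<^sub>1) \<dots> (S - \<lambda>\<^sub>r) a = 0\<close>. Keeping the
  roots in a list, instead of multiplying the factors out, lets them be removed one by one.
\<close>

fun annihilated_by :: "complex list \<Rightarrow> (nat \<Rightarrow> complex) \<Rightarrow> bool" where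
  "annihilated_by [] a \<longleftrightarrow> (\<forall>k. a k = 0)"
| "annihilated_by (l # ls) a \<longleftrightarrow> annihilated_by ls (\<lambda>k. a (Suc k) - l * a k)"

text \<open>
  A step \<open>S - 0\<close> undoes one shift, so shifting costs one additional root 0.
\<close>

lemma annihilated_by_shift:
  assumes "annihilated_by ls a" 
  shows "annihilated_by (replicate p 0 @ ls) (shift p a)"
proof (induction p)
  case 0
  then show ?case using assms by (simp add: shift_def[abs_def])
next
  case (Suc p)
  have "(\<lambda>k. shift (Suc p) a (Suc k) - 0 * shift (Suc p) a k) = shift p a"
    by (auto simp: shift_def)
  then show ?case using Suc.IH by simp
qed

text \<open>
  After \<open>length ls - 1\<close> zero coefficients, the next term bounds the whole series. Let \<open>f\<close> be the
  function, \<open>\<lambda>\<close> the first root and \<open>b = (S - \<lambda>) a\<close>, with generating function \<open>g\<close>. Then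
  \<open>f' = \<lambda> f + g\<close>, and \<open>b\<close> either has no root left and vanishes, or satisfies the hypotheses with
  one root and one leading zero less. Since \<open>Re \<lambda> \<le> 0\<close>, the modulus of \<open>f\<close> grows no faster than
  the integral of the bound for \<open>g\<close>.
\<close>

lemma phi_series_0_bound:
  assumes "annihilated_by ls a" "ls \<noteq> []"
    and "\<And>l. l \<in> set ls \<Longrightarrow> Re l \<le> 0"
    and "\<And>k. k + 1 < length ls \<Longrightarrow> a k = 0"
    and "geometrically_bounded a" and "0 \<le> t"
  shows "cmod (phi_series 0 a (of_real t))
     \<le> cmod (a (length ls - 1)) * t ^ (length ls - 1) / fact (length ls - 1)"
  using assms
proof (induction ls arbitrary: a t)
  case Nil
  then show ?case by simp
next
  case (Cons l ls)
  define b where "b k = a (Suc k) - l * a k" for k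
  define f where "f t = phi_series 0 a (of_real t)" for t :: real
  define g where "g t = phi_series 0 b (of_real t)" for t :: real
  have gb: "geometrically_bounded b" unfolding b_def
    by (intro geometrically_bounded_diff geometrically_bounded_Suc geometrically_bounded_cmult Cons.prems)
  have "phi_series 0 (\<lambda>k. a (Suc k)) (of_real t) = l * f t + g t" for t
  proof -
    have "phi_series 0 (\<lambda>k. l * a k + b k) (of_real t) = l * f t + g t"
      unfolding f_def g_def using Cons.prems gb
      by (simp add: phi_series_add phi_series_cmult geometrically_bounded_cmult)
    then show ?thesis by (simp add: b_def)
  qed
  then have f': "(f has_vector_derivative (l * f t + g t)) (at t)" for t
    using phi_series_0_deriv[OF Cons.prems(5)] unfolding f_def[abs_def] by simp
  have annb: "annihilated_by ls b" using Cons.prems(1) by (simp add: b_def[abs_def])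
  define d where "d = length ls"
  define G where "G t = cmod (a d) * t ^ d / fact d" for t :: real
  (* For d = 0 there is no root left, so g = 0 and the constant G suffices. *)
  define G' where "G' t = (if d = 0 then 0 else cmod (a d) * t ^ (d - 1) / fact (d - 1))" for t :: real
  have G: "(G has_real_derivative G' t) (at t)" for t
  proof (cases d)
    case 0
    then show ?thesis unfolding G_def[abs_def] G'_def by simp
  next
    case (Suc d')
    have "((\<lambda>t. cmod (a d) / fact d * t ^ d) has_real_derivative
        cmod (a d) / fact d * (real d * t ^ (d - Suc 0))) (at t)"
      by (intro DERIV_cmult DERIV_pow)
    then show ?thesis unfolding G_def[abs_def] G'_def Suc by (simp add: field_simps del: of_nat_Suc)
  qed
  have le: "cmod (g t) \<le> G' t" if "0 \<le> t" for t
  proof (cases "ls = []")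
    case True
    then have "b = (\<lambda>k. 0)" using annb by auto
    then show ?thesis using True by (simp add: g_def G'_def d_def phi_series_zero)
  next
    case False
    have "a (d - 1) = 0" using Cons.prems(4)[of "d - 1"] False by (simp add: d_def)
    then have "b (d - 1) = a d" using False by (simp add: b_def d_def)
    moreover have "b k = 0" if "k + 1 < length ls" for k
      using Cons.prems(4)[of k] Cons.prems(4)[of "Suc k"] that by (simp add: b_def)
    ultimately show ?thesis
      using Cons.IH[OF annb False _ _ gb \<open>0 \<le> t\<close>] Cons.prems(3) False
      by (simp add: g_def G'_def d_def)
  qed
  have norm1: "vnorm2 (vec 1 (\<lambda>_. z)) = cmod z" for z
    by (simp add: vnorm2_def L2_set_def)
  (* The scalar equation for f, read as a system of dimension one. *)
  let ?M = "mat 1 1 (\<lambda>_. l)"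
  have "vnorm2 (vec 1 (\<lambda>_. f t)) \<le> G t"
  proof (rule dissipative_ode_bound[where y = "\<lambda>t. vec 1 (\<lambda>_. f t)"
        and b = "\<lambda>t. vec 1 (\<lambda>_. g t)" and G = G and G' = G' and n = 1 and M = ?M])
    show "dissipative ?M"
      unfolding dissipative_def
    proof
      fix x :: "complex vec" assume x: "x \<in> carrier_vec (dim_row ?M)"
      then have "Re ((?M *\<^sub>v x) \<bullet>c x) = Re l * (cmod (x $ 0))\<^sup>2"
        unfolding cmod_power2 by (simp add: scalar_prod_def algebra_simps power2_eq_square)
      also have "\<dots> \<le> 0" using Cons.prems(3) by (simp add: mult_nonpos_nonneg)
      finally show "Re ((?M *\<^sub>v x) \<bullet>c x) \<le> 0" .
    qed
    show "((\<lambda>t. vec 1 (\<lambda>_. f t) $ i) has_vector_derivative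
        (?M *\<^sub>v vec 1 (\<lambda>_. f t) + vec 1 (\<lambda>_. g t)) $ i) (at t)" if "i < 1" for t i
      using f'[of t] that by (simp add: scalar_prod_def)
    show "vnorm2 (vec 1 (\<lambda>_. g t)) \<le> G' t" if "0 \<le> t" for t
      unfolding norm1 by (rule le[OF that])
    have "cmod (a 0) \<le> G 0"
      using Cons.prems(4)[of 0] by (cases "ls = []") (auto simp: G_def d_def)
    then show "vnorm2 (vec 1 (\<lambda>_. f 0)) \<le> G 0"
      unfolding norm1 by (simp add: f_def phi_series_at_0)
  qed (use G Cons.prems in auto)
  then show ?case unfolding norm1 by (simp add: f_def G_def d_def)
qed

section \<open>Powers of a matrix applied to a vector\<close>

lemma mult_mat_vec_index_sum:
  assumes "M \<in> carrier_mat nr n" "x \<in> carrier_vec n" "i < nr"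
  shows "(M *\<^sub>v x) $ i = (\<Sum>j<n. M $$ (i, j) * x $ j)"
  using assms by (simp add: scalar_prod_def lessThan_atLeast0)

lemma smult_mat_mult_vec:
  fixes M :: "complex mat"
  assumes "M \<in> carrier_mat nr n" "x \<in> carrier_vec n"
  shows "(c \<cdot>\<^sub>m M) *\<^sub>v x = c \<cdot>\<^sub>v (M *\<^sub>v x)"
  using assms by (intro eq_vecI) (auto simp: scalar_prod_def sum_distrib_left mult.assoc)

lemma pow_mat_Suc_mult_vec:
  fixes M :: "complex mat"
  assumes "M \<in> carrier_mat n n" "x \<in> carrier_vec n"
  shows "(M ^\<^sub>m Suc k) *\<^sub>v x = M *\<^sub>v ((M ^\<^sub>m k) *\<^sub>v x)"
    and "(M ^\<^sub>m Suc k) *\<^sub>v x = (M ^\<^sub>m k) *\<^sub>v (M *\<^sub>v x)"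
proof -
  have 2: "(M ^\<^sub>m Suc k) *\<^sub>v y = (M ^\<^sub>m k) *\<^sub>v (M *\<^sub>v y)" if "y \<in> carrier_vec n" for k y
    using assms that by (simp add: assoc_mult_mat_vec[of _ n n _ n])
  show "(M ^\<^sub>m Suc k) *\<^sub>v x = (M ^\<^sub>m k) *\<^sub>v (M *\<^sub>v x)" by (rule 2[OF assms(2)])
  show "(M ^\<^sub>m Suc k) *\<^sub>v x = M *\<^sub>v ((M ^\<^sub>m k) *\<^sub>v x)" using assms(2)
  proof (induction k arbitrary: x)
    case 0
    then show ?case using assms(1) by simp
  next
    case (Suc k)
    then have x: "M *\<^sub>v x \<in> carrier_vec n" using assms(1) by simp
    show ?case unfolding 2[OF Suc.prems, of "Suc k"] Suc.IH[OF x] 2[OF Suc.prems, of k] ..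
  qed
qed

lemma smult_mat_pow_mult_vec:
  fixes M :: "complex mat"
  assumes M: "M \<in> carrier_mat n n" and x: "x \<in> carrier_vec n"
  shows "((c \<cdot>\<^sub>m M) ^\<^sub>m k) *\<^sub>v x = c ^ k \<cdot>\<^sub>v ((M ^\<^sub>m k) *\<^sub>v x)"
proof (induction k)
  case 0
  then show ?case using M x by simp
next
  case (Suc k)
  have y: "(M ^\<^sub>m k) *\<^sub>v x \<in> carrier_vec n"
    by (rule mult_mat_vec_carrier[OF pow_carrier_mat[OF M] x])
  have "((c \<cdot>\<^sub>m M) ^\<^sub>m Suc k) *\<^sub>v x = (c \<cdot>\<^sub>m M) *\<^sub>v (c ^ k \<cdot>\<^sub>v ((M ^\<^sub>m k) *\<^sub>v x))"
    using M x by (subst pow_mat_Suc_mult_vec(1)[of _ n]) (auto simp: Suc)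
  also have "\<dots> = c \<cdot>\<^sub>v (c ^ k \<cdot>\<^sub>v (M *\<^sub>v ((M ^\<^sub>m k) *\<^sub>v x)))"
    using M y by (simp add: smult_mat_mult_vec[of _ n n] mult_mat_vec[of _ n n] smult_smult_assoc mult.commute)
  finally show ?case
    unfolding pow_mat_Suc_mult_vec(1)[OF M x] by (simp add: smult_smult_assoc)
qed

lemma geometrically_bounded_pow_mult_vec:
  fixes M :: "complex mat"
  assumes M: "M \<in> carrier_mat n n" and x: "x \<in> carrier_vec n" and i: "i < n"
  shows "geometrically_bounded (\<lambda>k. ((M ^\<^sub>m k) *\<^sub>v x) $ i)"
proof -
  define R where "R = (\<Sum>i<n. \<Sum>j<n. cmod (M $$ (i, j)))"
  define C where "C = (\<Sum>j<n. cmod (x $ j))"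
  have R: "(\<Sum>j<n. cmod (M $$ (i, j))) \<le> R" if "i < n" for i
    unfolding R_def using that
    by (intro member_le_sum[of i "{..<n}" "\<lambda>i. \<Sum>j<n. cmod (M $$ (i, j))"]) (auto intro: sum_nonneg)
  have C0: "0 \<le> C" and R0: "0 \<le> R" unfolding C_def R_def by (auto intro!: sum_nonneg)
  have "cmod (((M ^\<^sub>m k) *\<^sub>v x) $ i) \<le> C * R ^ k" if "i < n" for i k
    using that
  proof (induction k arbitrary: i)
    case 0
    have "cmod (x $ i) \<le> C" unfolding C_def using 0
      by (intro member_le_sum[of i "{..<n}" "\<lambda>i. cmod (x $ i)"]) auto
    then show ?case using M x by simp
  next
    case (Suc k)
    let ?y = "(M ^\<^sub>m k) *\<^sub>v x"
    have y: "?y \<in> carrier_vec n" by (rule mult_mat_vec_carrier[OF pow_carrier_mat[OF M] x])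
    have "(M *\<^sub>v ?y) $ i = (\<Sum>j<n. M $$ (i, j) * ?y $ j)"
      by (rule mult_mat_vec_index_sum[OF M y Suc.prems])
    then have "cmod ((M *\<^sub>v ?y) $ i) \<le> (\<Sum>j<n. cmod (M $$ (i, j)) * cmod (?y $ j))"
      by (auto intro!: order_trans[OF norm_sum] simp: norm_mult)
    also have "\<dots> \<le> (\<Sum>j<n. cmod (M $$ (i, j)) * (C * R ^ k))"
      by (intro sum_mono mult_left_mono Suc.IH) auto
    also have "\<dots> \<le> R * (C * R ^ k)"
      unfolding sum_distrib_right[symmetric] using R[OF Suc.prems] C0 R0
      by (intro mult_right_mono) auto
    finally show ?case unfolding pow_mat_Suc_mult_vec(1)[OF M x] by (simp add: mult_ac)
  qed
  then show ?thesis using i unfolding geometrically_bounded_def by blast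
qed

lemma phi_mat_mult_vec_index:
  assumes M: "M \<in> carrier_mat n n" and x: "x \<in> carrier_vec n" and i: "i < n"
  shows "(phi_mat p (z \<cdot>\<^sub>m M) *\<^sub>v x) $ i = phi_series p (\<lambda>k. ((M ^\<^sub>m k) *\<^sub>v x) $ i) z"
proof -
  have col: "(N ^\<^sub>m k) $$ (i, j) = ((N ^\<^sub>m k) *\<^sub>v unit_vec n j) $ i"
    if "j < n" "N \<in> carrier_mat n n" for j k and N :: "complex mat"
    using that i by (simp add: scalar_prod_right_unit)
  have gb: "geometrically_bounded (\<lambda>k. (M ^\<^sub>m k) $$ (i, j))" if "j < n" for j
    unfolding col[OF that M] by (rule geometrically_bounded_pow_mult_vec[OF M _ i]) simp
  have entry: "((z \<cdot>\<^sub>m M) ^\<^sub>m k) $$ (i, j) = (M ^\<^sub>m k) $$ (i, j) * z ^ k" if "j < n" for j k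
    unfolding col[OF that smult_carrier_mat[OF M]] col[OF that M]
      smult_mat_pow_mult_vec[OF M unit_vec_carrier]
    using i M by simp
  have "(phi_mat p (z \<cdot>\<^sub>m M) *\<^sub>v x) $ i = (\<Sum>j<n. phi_series p (\<lambda>k. (M ^\<^sub>m k) $$ (i, j)) z * x $ j)"
    using M x i by (simp add: phi_mat_def scalar_prod_def lessThan_atLeast0 phi_series_def entry)
  also have "\<dots> = (\<Sum>j<n. phi_series p (\<lambda>k. x $ j * (M ^\<^sub>m k) $$ (i, j)) z)"
    by (intro sum.cong refl) (simp add: phi_series_cmult[OF gb] mult.commute)
  also have "\<dots> = phi_series p (\<lambda>k. \<Sum>j<n. x $ j * (M ^\<^sub>m k) $$ (i, j)) z"
    by (intro phi_series_sum[symmetric] geometrically_bounded_cmult gb) auto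
  also have "(\<lambda>k. \<Sum>j<n. x $ j * (M ^\<^sub>m k) $$ (i, j)) = (\<lambda>k. ((M ^\<^sub>m k) *\<^sub>v x) $ i)"
    using M x i by (auto simp: scalar_prod_def lessThan_atLeast0 mult.commute)
  finally show ?thesis .
qed

section \<open>The characteristic recurrence of a matrix\<close>

text \<open>
  The operator \<open>S - \<lambda>\<close> on the scalar sequence amounts to replacing \<open>y\<close> by \<open>(U - \<lambda>) y\<close>. If \<open>\<lambda>\<close> is
  the diagonal entry in the last row where \<open>y\<close> may be nonzero, triangularity makes that
  component vanish. The diagonal entries must therefore be used from the bottom up.
\<close>

lemma annihilated_by_upper_triangular:
  fixes U :: "complex mat"
  assumes U: "U \<in> carrier_mat n n" "upper_triangular U" and c: "c \<in> carrier_vec n"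
    and "k \<le> n" "y \<in> carrier_vec n" "\<And>i. k \<le> i \<Longrightarrow> i < n \<Longrightarrow> y $ i = 0"
  shows "annihilated_by (rev (map (\<lambda>i. U $$ (i, i)) [0..<k])) (\<lambda>q. c \<bullet> ((U ^\<^sub>m q) *\<^sub>v y))"
  using assms(4-)
proof (induction k arbitrary: y)
  case 0
  then have "y = 0\<^sub>v n" by (intro eq_vecI) auto
  moreover have "(U ^\<^sub>m q) *\<^sub>v 0\<^sub>v n = 0\<^sub>v n" for q using U by (intro eq_vecI) auto
  ultimately show ?case using c by simp
next
  case (Suc k)
  let ?l = "U $$ (k, k)"
  define y' where "y' = U *\<^sub>v y - ?l \<cdot>\<^sub>v y"
  have y': "y' \<in> carrier_vec n" unfolding y'_def using U Suc.prems by auto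
  have "y' $ i = 0" if "k \<le> i" "i < n" for i
  proof -
    have "(U *\<^sub>v y) $ i = (\<Sum>j<n. U $$ (i, j) * y $ j)"
      by (rule mult_mat_vec_index_sum[OF U(1) Suc.prems(2) that(2)])
    also have "\<dots> = (\<Sum>j<n. if j = k then U $$ (i, k) * y $ k else 0)"
    proof (intro sum.cong refl)
      fix j assume "j \<in> {..<n}"
      then show "U $$ (i, j) * y $ j = (if j = k then U $$ (i, k) * y $ k else 0)"
        using upper_triangularD[OF U(2), of j i] U(1) Suc.prems(3)[of j] that by (cases j k rule: linorder_cases) auto
    qed
    also have "\<dots> = U $$ (i, k) * y $ k" using Suc.prems by simp
    also have "\<dots> = ?l * y $ i"
      using upper_triangularD[OF U(2), of k i] U(1) Suc.prems(3)[of i] that by (cases "i = k") auto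
    finally show ?thesis unfolding y'_def using U Suc.prems that by simp
  qed
  then have "annihilated_by (rev (map (\<lambda>i. U $$ (i, i)) [0..<k])) (\<lambda>q. c \<bullet> ((U ^\<^sub>m q) *\<^sub>v y'))"
    using Suc.IH[of y'] y' Suc.prems(1) by auto
  moreover have "c \<bullet> ((U ^\<^sub>m q) *\<^sub>v y') = c \<bullet> ((U ^\<^sub>m Suc q) *\<^sub>v y) - ?l * (c \<bullet> ((U ^\<^sub>m q) *\<^sub>v y))" for q
  proof -
    have p: "U ^\<^sub>m q \<in> carrier_mat n n" "U *\<^sub>v y \<in> carrier_vec n" using U Suc.prems by auto
    have "(U ^\<^sub>m q) *\<^sub>v y' = (U ^\<^sub>m Suc q) *\<^sub>v y - ?l \<cdot>\<^sub>v ((U ^\<^sub>m q) *\<^sub>v y)"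
      unfolding y'_def pow_mat_Suc_mult_vec(2)[OF U(1) Suc.prems(2)]
      using p Suc.prems(2)
      by (simp add: mult_minus_distrib_mat_vec[of _ n n] mult_mat_vec[of _ n n])
    moreover have "(U ^\<^sub>m Suc q) *\<^sub>v y \<in> carrier_vec n" "(U ^\<^sub>m q) *\<^sub>v y \<in> carrier_vec n"
      using Suc.prems(2) U(1) by (auto simp del: pow_mat.simps intro!: mult_mat_vec_carrier[of _ n n])
    ultimately show ?thesis
      using c by (simp add: scalar_prod_minus_distrib[of _ n] del: pow_mat.simps)
  qed
  ultimately show ?case by simp
qed

lemma dissipative_eigenvalue:
  assumes M: "M \<in> carrier_mat n n" "dissipative M" and ev: "eigenvalue M l"
  shows "Re l \<le> 0"
proof -
  obtain x where x: "x \<in> carrier_vec n" "x \<noteq> 0\<^sub>v n" "M *\<^sub>v x = l \<cdot>\<^sub>v x"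
    using ev M unfolding eigenvalue_def eigenvector_def by auto
  have "x \<bullet>c x > 0" using x by simp
  then have pos: "Re (x \<bullet>c x) > 0" "Im (x \<bullet>c x) = 0" by (auto simp: less_complex_def)
  have "(M *\<^sub>v x) \<bullet>c x = l * (x \<bullet>c x)" unfolding x(3) using x(1) by simp
  then have "Re l * Re (x \<bullet>c x) \<le> 0" using M x(1) pos(2) unfolding dissipative_def by auto
  then show ?thesis using pos(1) by (simp add: mult_le_0_iff)
qed

text \<open>
  A form of the Cayley--Hamilton theorem: the annihilating roots are the diagonal entries of an
  upper triangular matrix similar to \<open>M\<close>.
\<close>

lemma characteristic_recurrence:
  fixes M :: "complex mat"
  assumes M: "M \<in> carrier_mat n n" and c: "c \<in> carrier_vec n" and y: "y \<in> carrier_vec n"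
  obtains ls where "length ls = n" "\<And>l. l \<in> set ls \<Longrightarrow> eigenvalue M l"
    "annihilated_by ls (\<lambda>k. c \<bullet> ((M ^\<^sub>m k) *\<^sub>v y))"
proof -
  obtain es where "char_poly M = (\<Prod>a\<leftarrow>es. [:- a, 1:])" using char_poly_factorized[OF M] by blast
  from schur_decomposition_exists[OF M this]
  obtain U where U: "U \<in> carrier_mat n n" "upper_triangular U" "similar_mat M U" by blast
  then obtain P Q where wit: "similar_mat_wit M U P Q" unfolding similar_mat_def by blast
  have PQ: "P \<in> carrier_mat n n" "Q \<in> carrier_mat n n"
    using similar_mat_witD2[OF M wit] by auto
  define ls where "ls = rev (map (\<lambda>i. U $$ (i, i)) [0..<n])"
  have "(\<lambda>k. c \<bullet> ((M ^\<^sub>m k) *\<^sub>v y)) = (\<lambda>k. (transpose_mat P *\<^sub>v c) \<bullet> ((U ^\<^sub>m k) *\<^sub>v (Q *\<^sub>v y)))"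
  proof
    fix k
    have Uk: "U ^\<^sub>m k \<in> carrier_mat n n" using U(1) by simp
    have z: "(U ^\<^sub>m k) *\<^sub>v (Q *\<^sub>v y) \<in> carrier_vec n" using Uk PQ y by simp
    have "(M ^\<^sub>m k) *\<^sub>v y = P *\<^sub>v ((U ^\<^sub>m k) *\<^sub>v (Q *\<^sub>v y))"
      unfolding similar_mat_wit_pow_id[OF wit] using PQ Uk y
      by (simp add: assoc_mult_mat_vec[of _ n n _ n] mult_carrier_mat[of _ n n])
    then show "c \<bullet> ((M ^\<^sub>m k) *\<^sub>v y) = (transpose_mat P *\<^sub>v c) \<bullet> ((U ^\<^sub>m k) *\<^sub>v (Q *\<^sub>v y))"
      using transpose_vec_mult_scalar[OF PQ(1) z c] by simp
  qed
  moreover have "annihilated_by ls (\<lambda>k. (transpose_mat P *\<^sub>v c) \<bullet> ((U ^\<^sub>m k) *\<^sub>v (Q *\<^sub>v y)))"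
    unfolding ls_def using PQ c y
    by (intro annihilated_by_upper_triangular[OF U(1,2)]) auto
  moreover have "eigenvalue M l" if "l \<in> set ls" for l
  proof -
    have "l \<in> set (diag_mat U)" using that U(1) unfolding ls_def diag_mat_def by auto
    then have "poly (char_poly U) l = 0"
      unfolding char_poly_upper_triangular[OF U(1,2)] by (auto simp: poly_prod_list prod_list_zero_iff)
    then show ?thesis
      unfolding eigenvalue_root_char_poly[OF M] char_poly_similar[OF U(3)] .
  qed
  ultimately show ?thesis using that[of ls] by (simp add: ls_def)
qed

section \<open>The logarithmic norm and the field of values\<close>

lemma vnorm2_mult_le_opnorm2:
  assumes M: "M \<in> carrier_mat n n" and x: "x \<in> carrier_vec n" "vnorm2 x \<le> 1"
  shows "vnorm2 (M *\<^sub>v x) \<le> opnorm2 M"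
  unfolding opnorm2_def
proof (rule cSUP_upper)
  show "x \<in> {x \<in> carrier_vec (dim_col M). vnorm2 x \<le> 1}" using M x by auto
  have "vnorm2 (M *\<^sub>v x) \<le> (\<Sum>i<n. \<Sum>j<n. cmod (M $$ (i, j)))"
    if x: "x \<in> carrier_vec n" "vnorm2 x \<le> 1" for x
  proof -
    have "vnorm2 (M *\<^sub>v x) \<le> (\<Sum>i<n. cmod ((M *\<^sub>v x) $ i))"
      unfolding vnorm2_def using M x by (simp add: L2_set_le_sum del: index_mult_mat_vec(1))
    also have "\<dots> \<le> (\<Sum>i<n. \<Sum>j<n. cmod (M $$ (i, j)))"
    proof (rule sum_mono)
      fix i assume "i \<in> {..<n}"
      then have "(M *\<^sub>v x) $ i = (\<Sum>j<n. M $$ (i, j) * x $ j)"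
        using mult_mat_vec_index_sum[OF M x(1)] by simp
      moreover have "cmod (x $ j) \<le> 1" if "j < n" for j
        using member_le_L2_set[of "{..<n}" j "\<lambda>i. cmod (x $ i)"] that x unfolding vnorm2_def by auto
      ultimately show "cmod ((M *\<^sub>v x) $ i) \<le> (\<Sum>j<n. cmod (M $$ (i, j)))"
        by (auto intro!: order_trans[OF norm_sum] sum_mono simp: norm_mult mult_left_le)
    qed
    finally show ?thesis .
  qed
  then show "bdd_above ((\<lambda>x. vnorm2 (M *\<^sub>v x)) ` {x \<in> carrier_vec (dim_col M). vnorm2 x \<le> 1})"
    using M by (intro bdd_aboveI2) auto
qed

lemma opnorm2_le:
  assumes M: "M \<in> carrier_mat n n"
    and "\<And>x. x \<in> carrier_vec n \<Longrightarrow> vnorm2 x \<le> 1 \<Longrightarrow> vnorm2 (M *\<^sub>v x) \<le> C"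
  shows "opnorm2 M \<le> C"
  unfolding opnorm2_def
proof (rule cSUP_least)
  have "0\<^sub>v n \<in> {x \<in> carrier_vec (dim_col M). vnorm2 x \<le> 1}"
    using M by (simp add: vnorm2_eq_sqrt)
  then show "{x \<in> carrier_vec (dim_col M). vnorm2 x \<le> 1} \<noteq> {}" by blast
qed (use assms in auto)

lemma tendsto_at_right_mono_bounded:
  fixes f :: "real \<Rightarrow> real"
  assumes mono: "\<And>h k. 0 < h \<Longrightarrow> h < k \<Longrightarrow> f h \<le> f k" and bd: "\<And>h. 0 < h \<Longrightarrow> B \<le> f h"
  shows "(f \<longlongrightarrow> (INF h\<in>{0<..}. f h)) (at_right 0)"
proof (rule order_tendstoI)
  let ?L = "INF h\<in>{0<..}. f h"
  have bdd: "bdd_below (f ` {0<..})" using bd by (intro bdd_belowI2[of _ B]) auto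
  fix a
  {
    assume "a < ?L"
    then have "a < f h" if "0 < h" for h
      using cINF_lower[OF bdd, of h] that by auto
    then show "eventually (\<lambda>h. a < f h) (at_right 0)"
      unfolding eventually_at_right_field by (intro exI[of _ 1]) auto
  next
    assume "?L < a"
    then obtain k where k: "0 < k" "f k < a"
      using cINF_less_iff[OF _ bdd, of a] by auto
    then have "f h < a" if "0 < h" "h < k" for h using mono[OF that] by linarith
    then show "eventually (\<lambda>h. f h < a) (at_right 0)"
      unfolding eventually_at_right_field using k by blast
  }
qed

text \<open>
  The logarithmic norm is given by \<open>Lim\<close>, which carries information only if the limit exists. It
  does: the difference quotient is monotone in \<open>h\<close>, as the operator norm is convex, and it is
  bounded below by \<open>Re \<langle>M u, u\<rangle>\<close> for each unit vector \<open>u\<close>, because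
  \<open>1 + h Re \<langle>M u, u\<rangle> = Re \<langle>(1 + h M) u, u\<rangle>\<close> is at most the norm of \<open>1 + h M\<close>. The limit is the
  infimum, so these lower bounds hold for it as well.
\<close>

lemma dissipative_if_lognorm2_le_0:
  assumes M: "M \<in> carrier_mat n n" and le: "lognorm2 M \<le> 0"
  shows "dissipative M"
  unfolding dissipative_def
proof
  fix x :: "complex vec" assume "x \<in> carrier_vec (dim_row M)"
  then have x: "x \<in> carrier_vec n" using M by simp
  define P where "P h = 1\<^sub>m n + complex_of_real h \<cdot>\<^sub>m M" for h
  define q where "q h = (opnorm2 (P h) - 1) / h" for h
  have P: "P h \<in> carrier_mat n n" for h unfolding P_def using M by simp
  have Px: "P h *\<^sub>v y = y + complex_of_real h \<cdot>\<^sub>v (M *\<^sub>v y)" if "y \<in> carrier_vec n" for h y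
    unfolding P_def using M that
    by (simp add: add_mult_distrib_mat_vec[of _ n n] smult_mat_mult_vec[of _ n n])
  have mono: "q h \<le> q k" if "0 < h" "h < k" for h k
  proof -
      (* 1 + h M is the convex combination (1 - s) 1 + s (1 + k M). *)
    define s where "s = h / k"
    have s: "0 \<le> s" "s \<le> 1" "h = s * k" using that by (auto simp: s_def)
    have "opnorm2 (P h) \<le> (1 - s) + s * opnorm2 (P k)"
    proof (rule opnorm2_le[OF P])
      fix y :: "complex vec" assume y: "y \<in> carrier_vec n" "vnorm2 y \<le> 1"
      have My: "M *\<^sub>v y \<in> carrier_vec n" using M y by simp
      have "P h *\<^sub>v y = complex_of_real (1 - s) \<cdot>\<^sub>v y + complex_of_real s \<cdot>\<^sub>v (P k *\<^sub>v y)"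
        unfolding Px[OF y(1)] s(3) using M y(1) My
        by (intro eq_vecI) (auto simp: algebra_simps simp del: index_mult_mat_vec(1))
      then have "vnorm2 (P h *\<^sub>v y) \<le> (1 - s) * vnorm2 y + s * vnorm2 (P k *\<^sub>v y)"
        using vnorm2_add_le[of "complex_of_real (1 - s) \<cdot>\<^sub>v y" "complex_of_real s \<cdot>\<^sub>v (P k *\<^sub>v y)"] y P[of k] s
        by (simp add: vnorm2_smult del: of_real_diff)
      also have "\<dots> \<le> (1 - s) * 1 + s * opnorm2 (P k)"
        using s y vnorm2_mult_le_opnorm2[OF P y] by (intro add_mono mult_left_mono) auto
      finally show "vnorm2 (P h *\<^sub>v y) \<le> (1 - s) + s * opnorm2 (P k)" by simp
    qed
    then have "opnorm2 (P h) - 1 \<le> s * (opnorm2 (P k) - 1)" by (simp add: algebra_simps)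
    then show ?thesis unfolding q_def s_def using that by (simp add: field_simps)
  qed
  show "Re ((M *\<^sub>v x) \<bullet>c x) \<le> 0"
  proof (cases "vnorm2 x = 0")
    case True
    then show ?thesis using Re_cscalar_prod_le[of "M *\<^sub>v x" x] M x by simp
  next
    case False
    define u where "u = complex_of_real (1 / vnorm2 x) \<cdot>\<^sub>v x"
    have u: "u \<in> carrier_vec n" "vnorm2 u = 1"
      using x False vnorm2_nonneg[of x] unfolding u_def vnorm2_smult by (auto simp: norm_divide)
    have xu: "x = complex_of_real (vnorm2 x) \<cdot>\<^sub>v u"
      unfolding u_def using False by (intro eq_vecI) auto
    have lower: "Re ((M *\<^sub>v u) \<bullet>c u) \<le> q h" if "0 < h" for h
    proof -
      have "(P h *\<^sub>v u) \<bullet>c u = u \<bullet>c u + complex_of_real h * ((M *\<^sub>v u) \<bullet>c u)"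
        unfolding Px[OF u(1)] using M u(1) by (subst add_scalar_prod_distrib[of _ n]) auto
      then have "1 + h * Re ((M *\<^sub>v u) \<bullet>c u) = Re ((P h *\<^sub>v u) \<bullet>c u)"
        using vnorm2_squared[of u] u(2) by simp
      also have "\<dots> \<le> opnorm2 (P h)"
        using Re_cscalar_prod_le[of "P h *\<^sub>v u" u] vnorm2_mult_le_opnorm2[OF P[of h] u(1)] P[of h] u by auto
      finally show ?thesis unfolding q_def using that by (simp add: field_simps)
    qed
    have "(q \<longlongrightarrow> (INF h\<in>{0<..}. q h)) (at_right 0)"
      by (rule tendsto_at_right_mono_bounded[OF mono lower])
    then have "Lim (at_right 0) q = (INF h\<in>{0<..}. q h)"
      by (intro tendsto_Lim) auto
    moreover have "lognorm2 M = Lim (at_right 0) q"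
      unfolding lognorm2_def q_def[abs_def] P_def using M by simp
    moreover have "Re ((M *\<^sub>v u) \<bullet>c u) \<le> (INF h\<in>{0<..}. q h)"
      using lower by (intro cINF_greatest) auto
    ultimately have "Re ((M *\<^sub>v u) \<bullet>c u) \<le> 0" using le by simp
    moreover have "(M *\<^sub>v x) \<bullet>c x = complex_of_real ((vnorm2 x)\<^sup>2) * ((M *\<^sub>v u) \<bullet>c u)"
    proof -
      have "M *\<^sub>v x = complex_of_real (vnorm2 x) \<cdot>\<^sub>v (M *\<^sub>v u)"
        by (subst xu) (rule mult_mat_vec[OF M u(1)])
      moreover have "conjugate x = complex_of_real (vnorm2 x) \<cdot>\<^sub>v conjugate u"
        by (subst xu) (simp add: conjugate_smult_vec)
      ultimately show ?thesis using M u(1) by (simp add: power2_eq_square)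
    qed
    ultimately show ?thesis by (simp add: mult_nonneg_nonpos)
  qed
qed

lemma mat_adjoint_carrier:
  "V \<in> carrier_mat n m \<Longrightarrow> mat_adjoint V \<in> carrier_mat m n"
  unfolding mat_adjoint_def carrier_mat_def by auto

lemma mat_adjoint_cscalar_prod:
  fixes V :: "complex mat"
  assumes V: "V \<in> carrier_mat n m" and y: "y \<in> carrier_vec n" and x: "x \<in> carrier_vec m"
  shows "(mat_adjoint V *\<^sub>v y) \<bullet>c x = y \<bullet>c (V *\<^sub>v x)"
proof -
  have "(mat_adjoint V *\<^sub>v y) $ j = (\<Sum>i<n. cnj (V $$ (i, j)) * y $ i)" if "j < m" for j
    using that V y by (simp add: mat_adjoint_def mat_of_rows_row scalar_prod_def lessThan_atLeast0)
  then have "(mat_adjoint V *\<^sub>v y) \<bullet>c x = (\<Sum>j<m. \<Sum>i<n. cnj (V $$ (i, j)) * y $ i * cnj (x $ j))"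
    using x V by (simp add: scalar_prod_def[of _ "conjugate x"] lessThan_atLeast0 sum_distrib_right)
  also have "\<dots> = (\<Sum>i<n. \<Sum>j<m. cnj (V $$ (i, j)) * y $ i * cnj (x $ j))" by (rule sum.swap)
  also have "\<dots> = y \<bullet>c (V *\<^sub>v x)"
    using V x by (simp add: scalar_prod_def lessThan_atLeast0 sum_distrib_left mult_ac)
  finally show ?thesis .
qed

text \<open>
  The quadratic form of the compression at \<open>x\<close> is the one of \<open>M\<close> at \<open>V x\<close>.
\<close>

lemma dissipative_compression:
  assumes M: "M \<in> carrier_mat n n" "dissipative M" and V: "V \<in> carrier_mat n m"
  shows "dissipative (mat_adjoint V * M * V)"
  unfolding dissipative_def
proof
  note V' = mat_adjoint_carrier[OF V]
  fix x :: "complex vec" assume "x \<in> carrier_vec (dim_row (mat_adjoint V * M * V))"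
  then have x: "x \<in> carrier_vec m" using V' by simp
  have Vx: "V *\<^sub>v x \<in> carrier_vec n" using V x by simp
  have "mat_adjoint V * M * V *\<^sub>v x = mat_adjoint V *\<^sub>v (M *\<^sub>v (V *\<^sub>v x))"
    using M V V' x Vx by (simp add: assoc_mult_mat_vec[of _ m n _ m] assoc_mult_mat_vec[of _ m n _ n]
        mult_carrier_mat[of _ m n])
  then have "(mat_adjoint V * M * V *\<^sub>v x) \<bullet>c x = (M *\<^sub>v (V *\<^sub>v x)) \<bullet>c (V *\<^sub>v x)"
    using mat_adjoint_cscalar_prod[OF V _ x, of "M *\<^sub>v (V *\<^sub>v x)"] M Vx by simp
  then show "Re ((mat_adjoint V * M * V *\<^sub>v x) \<bullet>c x) \<le> 0"
    using M Vx unfolding dissipative_def by simp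
qed

section \<open>The corrected Krylov approximation\<close>

locale scaled_krylov_decomposition = krylov_decomposition +
  fixes \<sigma> :: complex
  assumes A_carrier: "A \<in> carrier_mat n n" and v_carrier: "v \<in> carrier_vec n"
    and sigma_norm: "cmod \<sigma> = 1" and m_pos: "0 < m"
begin

abbreviation M :: "complex mat" where "M \<equiv> \<sigma> \<cdot>\<^sub>m A"

definition T_iter :: "nat \<Rightarrow> complex vec" where
  "T_iter k = ((\<sigma> \<cdot>\<^sub>m T) ^\<^sub>m k) *\<^sub>v unit_vec m 0"

definition T_plus_iter :: "nat \<Rightarrow> complex vec" where
  "T_plus_iter k = ((\<sigma> \<cdot>\<^sub>m T_plus T \<tau>) ^\<^sub>m k) *\<^sub>v unit_vec (m + 1) 0"

text \<open>
  The last component of \<open>T_plus_iter k\<close> (see \<open>T_plus_iter_eq\<close>). Written as a shift, it shows which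
  linear recurrence it satisfies.
\<close>

definition last_iter :: "nat \<Rightarrow> complex" where
  "last_iter = shift 1 (\<lambda>k. ((\<sigma> * \<tau>) \<cdot>\<^sub>v unit_vec m (m - 1)) \<bullet> T_iter k)"

text \<open>
  The coefficients of the error series (see \<open>error_index\<close>).
\<close>

definition err_coeff :: "nat \<Rightarrow> complex vec" where
  "err_coeff k = (M ^\<^sub>m k) *\<^sub>v v - V_plus V w *\<^sub>v T_plus_iter k"

lemma M_carrier: "M \<in> carrier_mat n n"
  using A_carrier by simp

lemma sT_carrier: "\<sigma> \<cdot>\<^sub>m T \<in> carrier_mat m m"
  using T_carrier by simp

lemma T_plus_carrier: "T_plus T \<tau> \<in> carrier_mat (m + 1) (m + 1)"
  using T_carrier unfolding T_plus_def Let_def by auto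

lemma V_plus_carrier: "V_plus V w \<in> carrier_mat n (m + 1)"
  using V_carrier unfolding V_plus_def by auto

lemma T_iter_carrier: "T_iter k \<in> carrier_vec m"
  unfolding T_iter_def by (rule mult_mat_vec_carrier[OF pow_carrier_mat[OF sT_carrier]]) simp

lemma T_plus_iter_carrier: "T_plus_iter k \<in> carrier_vec (m + 1)"
  unfolding T_plus_iter_def using T_plus_carrier by (intro mult_mat_vec_carrier[OF pow_carrier_mat]) auto

lemma err_coeff_carrier: "err_coeff k \<in> carrier_vec n"
  unfolding err_coeff_def using carrier_matD(1)[OF V_plus_carrier] by (intro carrier_vecI) simp

lemma T_iter_Suc: "T_iter (Suc k) = \<sigma> \<cdot>\<^sub>v (T *\<^sub>v T_iter k)"
  using pow_mat_Suc_mult_vec(1)[OF sT_carrier, of "unit_vec m 0" k]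
    smult_mat_mult_vec[OF T_carrier T_iter_carrier]
  by (simp add: T_iter_def)

lemma last_iter_Suc: "last_iter (Suc k) = \<sigma> * (\<tau> * T_iter k $ (m - 1))"
  using T_iter_carrier[of k] m_pos by (simp add: last_iter_def shift_def)

lemma T_plus_mult_append:
  assumes y: "y \<in> carrier_vec m"
  shows "T_plus T \<tau> *\<^sub>v (y @\<^sub>v vec 1 (\<lambda>_. z)) = (T *\<^sub>v y) @\<^sub>v vec 1 (\<lambda>_. \<tau> * y $ (m - 1))"
proof -
  let ?R = "mat_of_rows m [complex_of_real \<tau> \<cdot>\<^sub>v unit_vec m (m - 1)]"
  have "T_plus T \<tau> *\<^sub>v (y @\<^sub>v vec 1 (\<lambda>_. z)) =
      (T *\<^sub>v y + 0\<^sub>m m 1 *\<^sub>v vec 1 (\<lambda>_. z)) @\<^sub>v (?R *\<^sub>v y + 0\<^sub>m 1 1 *\<^sub>v vec 1 (\<lambda>_. z))"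
    unfolding T_plus_def Let_def carrier_matD(1)[OF T_carrier]
    using T_carrier y by (intro four_block_mat_mult_vec[of _ m m _ 1 _ 1]) auto
  also have "T *\<^sub>v y + 0\<^sub>m m 1 *\<^sub>v vec 1 (\<lambda>_. z) = T *\<^sub>v y"
    using T_carrier by (intro eq_vecI) auto
  also have "?R *\<^sub>v y + 0\<^sub>m 1 1 *\<^sub>v vec 1 (\<lambda>_. z) = vec 1 (\<lambda>_. \<tau> * y $ (m - 1))"
    using y m_pos by (intro eq_vecI) (auto simp: mat_of_rows_row)
  finally show ?thesis .
qed

lemma V_plus_mult_append:
  assumes y: "y \<in> carrier_vec m"
  shows "V_plus V w *\<^sub>v (y @\<^sub>v vec 1 (\<lambda>_. z)) = V *\<^sub>v y + z \<cdot>\<^sub>v w"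
proof (rule eq_vecI)
  fix i assume "i < dim_vec (V *\<^sub>v y + z \<cdot>\<^sub>v w)"
  then have i: "i < n" using w_carrier by simp
  have "V_plus V w $$ (i, j) = V $$ (i, j)" if "j < m" for j
    using i that V_carrier by (simp add: V_plus_def mat_of_cols_def nth_append)
  moreover have "V_plus V w $$ (i, m) = w $ i"
    using i V_carrier by (simp add: V_plus_def mat_of_cols_def nth_append)
  ultimately show "(V_plus V w *\<^sub>v (y @\<^sub>v vec 1 (\<lambda>_. z))) $ i = (V *\<^sub>v y + z \<cdot>\<^sub>v w) $ i"
    using i V_plus_carrier V_carrier w_carrier y by (simp add: scalar_prod_def mult.commute)
qed (use V_plus_carrier w_carrier in auto)

lemma A_mult_V_mult:
  assumes y: "y \<in> carrier_vec m"
  shows "A *\<^sub>v (V *\<^sub>v y) = V *\<^sub>v (T *\<^sub>v y) + (\<tau> * y $ (m - 1)) \<cdot>\<^sub>v w"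
proof -
  let ?W = "mat_of_cols n [w]" and ?E = "mat_of_rows m [unit_vec m (m - 1)]"
  have WE: "?W \<in> carrier_mat n 1" "?E \<in> carrier_mat 1 m" by auto
  have "?E *\<^sub>v y = vec 1 (\<lambda>_. y $ (m - 1))"
    using y m_pos by (intro eq_vecI) (auto simp: mat_of_rows_row)
  moreover have "?W *\<^sub>v vec 1 (\<lambda>_. c) = c \<cdot>\<^sub>v w" for c
    using w_carrier by (intro eq_vecI) (auto simp: scalar_prod_def mat_of_cols_def)
  ultimately have "(?W * ?E) *\<^sub>v y = y $ (m - 1) \<cdot>\<^sub>v w"
    by (simp only: assoc_mult_mat_vec[OF WE y])
  then have "(complex_of_real \<tau> \<cdot>\<^sub>m (?W * ?E)) *\<^sub>v y = (\<tau> * y $ (m - 1)) \<cdot>\<^sub>v w"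
    unfolding smult_mat_mult_vec[OF mult_carrier_mat[OF WE] y] by (simp only: smult_smult_assoc)
  moreover have "(A * V) *\<^sub>v y = (V * T) *\<^sub>v y + (complex_of_real \<tau> \<cdot>\<^sub>m (?W * ?E)) *\<^sub>v y"
    unfolding recurrence using V_carrier T_carrier y
    by (intro add_mult_distrib_mat_vec[of _ n m]) (auto intro!: mult_carrier_mat[of _ n 1])
  ultimately show ?thesis
    using A_carrier V_carrier T_carrier y
    by (simp add: assoc_mult_mat_vec[of _ n n _ m] assoc_mult_mat_vec[of _ n m _ m])
qed

lemma T_plus_iter_eq: "T_plus_iter k = T_iter k @\<^sub>v vec 1 (\<lambda>_. last_iter k)"
proof (induction k)
  case 0
  show ?case
    unfolding T_plus_iter_def T_iter_def using T_plus_carrier T_carrier m_pos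
    by (intro eq_vecI) (auto simp: last_iter_def shift_def)
next
  case (Suc k)
  have "T_plus_iter (Suc k) = \<sigma> \<cdot>\<^sub>v (T_plus T \<tau> *\<^sub>v T_plus_iter k)"
    using pow_mat_Suc_mult_vec(1)[of "\<sigma> \<cdot>\<^sub>m T_plus T \<tau>" "m + 1" "unit_vec (m + 1) 0" k]
      smult_mat_mult_vec[OF T_plus_carrier T_plus_iter_carrier] T_plus_carrier
    by (simp add: T_plus_iter_def)
  also have "\<dots> = T_iter (Suc k) @\<^sub>v vec 1 (\<lambda>_. last_iter (Suc k))"
    unfolding Suc T_plus_mult_append[OF T_iter_carrier] T_iter_Suc last_iter_Suc
    using T_carrier by (intro eq_vecI) (auto simp del: index_mult_mat_vec(1))
  finally show ?case .
qed

lemma err_coeff_0: "err_coeff 0 = 0\<^sub>v n"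
proof -
  have "T_iter 0 = unit_vec m 0" using T_carrier by (simp add: T_iter_def)
  moreover have "last_iter 0 = 0" by (simp add: last_iter_def shift_def)
  ultimately have "V_plus V w *\<^sub>v T_plus_iter 0 = v"
    unfolding T_plus_iter_eq V_plus_mult_append[OF T_iter_carrier] using V_first w_carrier v_carrier
    by (intro eq_vecI) auto
  then show ?thesis unfolding err_coeff_def using M_carrier v_carrier A_carrier by simp
qed

text \<open>
  By the Krylov recurrence \<open>V\<^sup>+ T\<^sup>+\<close> agrees with \<open>A [V | 0]\<close>. The approximations thus satisfy the
  recurrence of the exact powers, except that the component in direction \<open>w\<close> is dropped in every
  step; this defect is the source term.
\<close>

lemma err_coeff_Suc: "err_coeff (Suc k) = M *\<^sub>v err_coeff k + last_iter k \<cdot>\<^sub>v (M *\<^sub>v w)"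
proof -
  have uk: "T_iter k \<in> carrier_vec m" "T *\<^sub>v T_iter k \<in> carrier_vec m" "V *\<^sub>v T_iter k \<in> carrier_vec n"
    using T_iter_carrier[of k] T_carrier V_carrier by auto
  have y: "(M ^\<^sub>m k) *\<^sub>v v \<in> carrier_vec n"
    by (rule mult_mat_vec_carrier[OF pow_carrier_mat[OF M_carrier] v_carrier])
  have Vu: "V_plus V w *\<^sub>v T_plus_iter (Suc k) = M *\<^sub>v (V *\<^sub>v T_iter k)"
    unfolding T_plus_iter_eq V_plus_mult_append[OF T_iter_carrier]
    unfolding T_iter_Suc last_iter_Suc
      smult_mat_mult_vec[OF A_carrier uk(3)] A_mult_V_mult[OF uk(1)] mult_mat_vec[OF V_carrier uk(2)]
    using V_carrier w_carrier
    by (intro eq_vecI) (auto simp: algebra_simps simp del: index_mult_mat_vec(1))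
  have "M *\<^sub>v err_coeff k = M *\<^sub>v ((M ^\<^sub>m k) *\<^sub>v v) - M *\<^sub>v (V *\<^sub>v T_iter k + last_iter k \<cdot>\<^sub>v w)"
    unfolding err_coeff_def T_plus_iter_eq V_plus_mult_append[OF T_iter_carrier]
    using y uk w_carrier M_carrier by (intro mult_minus_distrib_mat_vec) auto
  also have "M *\<^sub>v (V *\<^sub>v T_iter k + last_iter k \<cdot>\<^sub>v w) = M *\<^sub>v (V *\<^sub>v T_iter k) + last_iter k \<cdot>\<^sub>v (M *\<^sub>v w)"
    using mult_add_distrib_mat_vec[OF M_carrier uk(3), of "last_iter k \<cdot>\<^sub>v w"]
      mult_mat_vec[OF M_carrier w_carrier] w_carrier by simp
  finally have "M *\<^sub>v err_coeff k = M *\<^sub>v ((M ^\<^sub>m k) *\<^sub>v v) - (M *\<^sub>v (V *\<^sub>v T_iter k) + last_iter k \<cdot>\<^sub>v (M *\<^sub>v w))" .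
  then show ?thesis
    unfolding err_coeff_def[of "Suc k"] Vu pow_mat_Suc_mult_vec(1)[OF M_carrier v_carrier]
    using A_carrier
    by (intro eq_vecI) (auto simp del: index_mult_mat_vec(1))
qed

lemma gamma_real: "krylov_gamma T = complex_of_real (Re (krylov_gamma T))" "0 < Re (krylov_gamma T)"
  using krylov_gamma_pos[OF m_pos] by (auto simp: less_complex_def complex_eq_iff)

text \<open>
  The Hessenberg structure keeps the last component of \<open>T\<^sup>k e\<^sub>1\<close> at 0 until \<open>k = m - 1\<close>, when it
  becomes \<open>\<gamma>\<close>; the additional row of \<open>T\<^sup>+\<close> delays this by one step.
\<close>

lemma last_iter_eq_0: "k < m \<Longrightarrow> last_iter k = 0"
  and last_iter_m: "last_iter m = \<sigma> ^ m * \<tau> * krylov_gamma T"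
proof -
  have Tk: "(T ^\<^sub>m k) *\<^sub>v unit_vec m 0 \<in> carrier_vec m" for k
    by (rule mult_mat_vec_carrier[OF pow_carrier_mat[OF T_carrier]]) simp
  have uk: "T_iter k $ (m - 1) = \<sigma> ^ k * ((T ^\<^sub>m k) *\<^sub>v unit_vec m 0) $ (m - 1)" for k
    unfolding T_iter_def smult_mat_pow_mult_vec[OF T_carrier unit_vec_carrier]
    using T_carrier m_pos by (simp del: index_mult_mat_vec(1))
  show "last_iter k = 0" if "k < m"
  proof (cases k)
    case 0
    then show ?thesis by (simp add: last_iter_def shift_def)
  next
    case (Suc j)
    then have "((T ^\<^sub>m j) *\<^sub>v unit_vec m 0) $ (m - 1) = 0"
      using upper_hessenberg_pow_first_column[OF T_carrier T_hessenberg m_pos, of j] that by auto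
    then show ?thesis unfolding Suc last_iter_Suc uk by simp
  qed
  have "krylov_gamma T = ((T ^\<^sub>m (m - 1)) *\<^sub>v unit_vec m 0) $ (m - 1)"
    unfolding krylov_gamma_def Let_def carrier_matD(1)[OF T_carrier]
    using Tk[of "m - 1"] m_pos by (simp add: scalar_prod_left_unit del: index_mult_mat_vec(1))
  then have "last_iter (Suc (m - 1)) = \<sigma> ^ Suc (m - 1) * \<tau> * krylov_gamma T"
    unfolding last_iter_Suc uk by simp
  then show "last_iter m = \<sigma> ^ m * \<tau> * krylov_gamma T" using m_pos by simp
qed

lemma err_coeff_eq_0: "k \<le> m \<Longrightarrow> err_coeff k = 0\<^sub>v n"
proof (induction k)
  case 0
  show ?case by (rule err_coeff_0)
next
  case (Suc k)
  then show ?case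
    unfolding err_coeff_Suc using A_carrier w_carrier last_iter_eq_0[of k] by (intro eq_vecI) auto
qed

lemma err_coeff_m1: "err_coeff (m + 1) = (\<sigma> ^ (m + 1) * \<tau> * krylov_gamma T) \<cdot>\<^sub>v (A *\<^sub>v w)"
proof -
  have "M *\<^sub>v 0\<^sub>v n = 0\<^sub>v n" using A_carrier by (intro eq_vecI) auto
  then show ?thesis
    unfolding Suc_eq_plus1[symmetric] err_coeff_Suc err_coeff_eq_0[OF order_refl] last_iter_m
      smult_mat_mult_vec[OF A_carrier w_carrier]
    using A_carrier by (intro eq_vecI) (auto simp: mult_ac simp del: index_mult_mat_vec(1))
qed

lemma geometrically_bounded_T_plus_iter: "j < m + 1 \<Longrightarrow> geometrically_bounded (\<lambda>k. T_plus_iter k $ j)"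
  unfolding T_plus_iter_def using T_plus_carrier
  by (intro geometrically_bounded_pow_mult_vec[of _ "m + 1"]) auto

lemma V_plus_T_plus_iter_index:
  assumes "i < n"
  shows "(V_plus V w *\<^sub>v T_plus_iter k) $ i = (\<Sum>j<m+1. V_plus V w $$ (i, j) * T_plus_iter k $ j)"
  by (rule mult_mat_vec_index_sum[OF V_plus_carrier T_plus_iter_carrier assms])

lemma geometrically_bounded_V_plus_T_plus_iter:
  "i < n \<Longrightarrow> geometrically_bounded (\<lambda>k. (V_plus V w *\<^sub>v T_plus_iter k) $ i)"
  unfolding V_plus_T_plus_iter_index
  by (intro geometrically_bounded_sum geometrically_bounded_cmult geometrically_bounded_T_plus_iter) auto

lemma err_coeff_index:
  "i < n \<Longrightarrow> err_coeff k $ i = ((M ^\<^sub>m k) *\<^sub>v v) $ i - (V_plus V w *\<^sub>v T_plus_iter k) $ i"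
  unfolding err_coeff_def using V_plus_carrier by (simp del: index_mult_mat_vec(1))

lemma geometrically_bounded_err_coeff: "i < n \<Longrightarrow> geometrically_bounded (\<lambda>k. err_coeff k $ i)"
  by (simp only: err_coeff_index)
    (intro geometrically_bounded_diff geometrically_bounded_V_plus_T_plus_iter
      geometrically_bounded_pow_mult_vec[OF M_carrier v_carrier])

lemma geometrically_bounded_last_iter: "geometrically_bounded last_iter"
proof -
  have "geometrically_bounded (\<lambda>k. T_iter k $ (m - 1))"
    unfolding T_iter_def using m_pos by (intro geometrically_bounded_pow_mult_vec[OF sT_carrier]) auto
  then have "geometrically_bounded (\<lambda>k. (\<sigma> * \<tau>) * T_iter k $ (m - 1))"
    by (rule geometrically_bounded_cmult)
  moreover have "((\<sigma> * \<tau>) \<cdot>\<^sub>v unit_vec m (m - 1)) \<bullet> T_iter k = (\<sigma> * \<tau>) * T_iter k $ (m - 1)" for k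
    using T_iter_carrier[of k] m_pos by simp
  ultimately show ?thesis unfolding last_iter_def by (simp only: geometrically_bounded_shift)
qed

lemma error_carrier: "corrected_krylov_error p \<sigma> A v V T \<tau> w t \<in> carrier_vec n"
  unfolding corrected_krylov_error_def using carrier_matD(1)[OF V_plus_carrier]
  by (intro carrier_vecI) simp

lemma error_index:
  assumes i: "i < n"
  shows "corrected_krylov_error p \<sigma> A v V T \<tau> w t $ i = phi_series p (\<lambda>k. err_coeff k $ i) (of_real t)"
proof -
  let ?t = "complex_of_real t"
  let ?y = "phi_mat p (?t \<cdot>\<^sub>m (\<sigma> \<cdot>\<^sub>m T_plus T \<tau>)) *\<^sub>v unit_vec (m + 1) 0"
  have scale: "(\<sigma> * ?t) \<cdot>\<^sub>m B = ?t \<cdot>\<^sub>m (\<sigma> \<cdot>\<^sub>m B)" for B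
    by (intro eq_matI) auto
  have y: "?y \<in> carrier_vec (m + 1)"
    using T_plus_carrier by (intro carrier_vecI) (simp add: phi_mat_def)
  have "(V_plus V w *\<^sub>v ?y) $ i = (\<Sum>j<m+1. V_plus V w $$ (i, j) * ?y $ j)"
    by (rule mult_mat_vec_index_sum[OF V_plus_carrier y i])
  also have "\<dots> = (\<Sum>j<m+1. phi_series p (\<lambda>k. V_plus V w $$ (i, j) * T_plus_iter k $ j) ?t)"
  proof (intro sum.cong refl)
    fix j assume "j \<in> {..<m+1}"
    then have j: "j < m + 1" by simp
    have "?y $ j = phi_series p (\<lambda>k. T_plus_iter k $ j) ?t"
      unfolding T_plus_iter_def using T_plus_carrier j by (intro phi_mat_mult_vec_index[of _ "m + 1"]) auto
    then show "V_plus V w $$ (i, j) * ?y $ j = phi_series p (\<lambda>k. V_plus V w $$ (i, j) * T_plus_iter k $ j) ?t"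
      by (simp only: phi_series_cmult[OF geometrically_bounded_T_plus_iter[OF j]])
  qed
  also have "\<dots> = phi_series p (\<lambda>k. (V_plus V w *\<^sub>v T_plus_iter k) $ i) ?t"
    unfolding V_plus_T_plus_iter_index[OF i]
    by (intro phi_series_sum[symmetric] geometrically_bounded_cmult geometrically_bounded_T_plus_iter) auto
  finally have 2: "(V_plus V w *\<^sub>v ?y) $ i = phi_series p (\<lambda>k. (V_plus V w *\<^sub>v T_plus_iter k) $ i) ?t" .
  have 1: "(phi_mat p (?t \<cdot>\<^sub>m M) *\<^sub>v v) $ i = phi_series p (\<lambda>k. ((M ^\<^sub>m k) *\<^sub>v v) $ i) ?t"
    by (rule phi_mat_mult_vec_index[OF M_carrier v_carrier i])
  have "corrected_krylov_error p \<sigma> A v V T \<tau> w t $ i =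
      (phi_mat p (?t \<cdot>\<^sub>m M) *\<^sub>v v) $ i - (V_plus V w *\<^sub>v ?y) $ i"
    unfolding corrected_krylov_error_def scale carrier_matD(1)[OF T_carrier]
    using i V_plus_carrier by (simp del: index_mult_mat_vec(1))
  also have "\<dots> = phi_series p (\<lambda>k. err_coeff k $ i) ?t"
    unfolding 1 2 err_coeff_index[OF i]
    by (intro phi_series_diff[symmetric] geometrically_bounded_V_plus_T_plus_iter i
        geometrically_bounded_pow_mult_vec[OF M_carrier v_carrier])
  finally show ?thesis .
qed

definition lead :: "nat \<Rightarrow> real \<Rightarrow> complex vec" where
  "lead p t = (complex_of_real \<tau> * krylov_gamma T * ((\<sigma> * complex_of_real t) ^ (m + 1) / fact (m + p + 1)))
              \<cdot>\<^sub>v (A *\<^sub>v w)"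

lemma lead_carrier: "lead p t \<in> carrier_vec n"
  unfolding lead_def using A_carrier by (intro carrier_vecI) simp

text \<open>
  All terms of the error series before index \<open>m + 1\<close> vanish by \<open>err_coeff_eq_0\<close>, and the term of
  that index is \<open>lead p t\<close> by \<open>err_coeff_m1\<close>.
\<close>

lemma error_minus_lead:
  "(\<lambda>t. vnorm2 (corrected_krylov_error p \<sigma> A v V T \<tau> w t - lead p t)) \<in> O[at_right 0](\<lambda>t. t ^ (m + 2))"
proof -
  let ?r = "\<lambda>i t. phi_series p (\<lambda>k. err_coeff k $ i) (complex_of_real t) -
      err_coeff (m + 1) $ i * complex_of_real t ^ (m + 1) / fact (m + 1 + p)"
  have idx: "(corrected_krylov_error p \<sigma> A v V T \<tau> w t - lead p t) $ i = ?r i t" if "i < n" for i t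
    using that A_carrier lead_carrier[of p t] error_index[OF that, of p t] unfolding err_coeff_m1
    by (simp add: lead_def power_mult_distrib add_ac del: index_mult_mat_vec(1) fact_Suc power_Suc)
  have "(\<lambda>t. vnorm2 (corrected_krylov_error p \<sigma> A v V T \<tau> w t - lead p t))
      \<in> O[at_right 0](\<lambda>t. \<Sum>i<n. cmod (?r i t))"
  proof (intro bigoI[where c = 1] always_eventually allI)
    fix t
    have "vnorm2 (corrected_krylov_error p \<sigma> A v V T \<tau> w t - lead p t) \<le> (\<Sum>i<n. cmod (?r i t))"
      using lead_carrier[of p t] idx[of _ t] unfolding vnorm2_def
      by (intro order_trans[OF L2_set_le_sum]) auto
    then show "norm (vnorm2 (corrected_krylov_error p \<sigma> A v V T \<tau> w t - lead p t))
        \<le> 1 * norm (\<Sum>i<n. cmod (?r i t))"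
      using vnorm2_nonneg by (simp add: sum_nonneg)
  qed
  also have "(\<lambda>t. \<Sum>i<n. cmod (?r i t)) \<in> O[at_right 0](\<lambda>t. t ^ Suc (m + 1))"
  proof (rule big_sum_in_bigo)
    fix i assume "i \<in> {..<n}"
    then have i: "i < n" by simp
    have "err_coeff k $ i = 0" if "k < m + 1" for k using err_coeff_eq_0[of k] that i by simp
    then show "(\<lambda>t. cmod (?r i t)) \<in> O[at_right 0](\<lambda>t. t ^ Suc (m + 1))"
      by (rule phi_series_remainder[OF geometrically_bounded_err_coeff[OF i]])
  qed
  finally show ?thesis by simp
qed

lemma vnorm2_lead:
  assumes "0 \<le> t"
  shows "vnorm2 (lead p t) =
    vnorm2 (A *\<^sub>v w) * \<tau> * Re (krylov_gamma T) * (t ^ (m + 1) / fact (m + p + 1))"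
proof -
  have "cmod (krylov_gamma T) = Re (krylov_gamma T)"
    using gamma_real by (metis abs_of_pos norm_of_real)
  then show ?thesis
    unfolding lead_def vnorm2_smult norm_mult norm_divide norm_power
    using assms tau_pos sigma_norm by (simp add: mult_ac del: fact_Suc power_Suc)
qed

text \<open>
  There are \<open>m\<close> roots from \<open>\<sigma> T\<close>, one root 0 for the last row of \<open>T\<^sup>+\<close> and \<open>p\<close> roots 0 for the
  factor \<open>t\<^sup>p\<close>. The resulting exponent \<open>m + p\<close> is the index of the first nonzero coefficient,
  \<open>last_iter m\<close>.
\<close>

lemma last_iter_series_bound:
  assumes diss: "dissipative M" and t: "0 \<le> t"
  shows "cmod (phi_series 0 (shift p last_iter) (of_real t))
    \<le> \<tau> * Re (krylov_gamma T) * t ^ (m + p) / fact (m + p)"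
proof -
  have "\<sigma> \<cdot>\<^sub>m T = mat_adjoint V * M * V"
    unfolding T_def using mat_adjoint_carrier[OF V_carrier] A_carrier V_carrier
    by (simp add: mult_smult_distrib[of _ m n] mult_smult_assoc_mat[of _ m n _ m] mult_carrier_mat[of _ m n])
  then have dissT: "dissipative (\<sigma> \<cdot>\<^sub>m T)"
    using dissipative_compression[OF M_carrier diss V_carrier] by simp
  obtain ls where ls: "length ls = m" "\<And>l. l \<in> set ls \<Longrightarrow> eigenvalue (\<sigma> \<cdot>\<^sub>m T) l"
    "annihilated_by ls (\<lambda>k. ((\<sigma> * \<tau>) \<cdot>\<^sub>v unit_vec m (m - 1)) \<bullet> T_iter k)"
    using characteristic_recurrence[OF sT_carrier, of "(\<sigma> * \<tau>) \<cdot>\<^sub>v unit_vec m (m - 1)" "unit_vec m 0"]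
    unfolding T_iter_def by auto
  define ls' where "ls' = replicate p 0 @ replicate 1 0 @ ls"
  have len1: "length ls' - 1 = m + p" and len: "length ls' = m + p + 1" unfolding ls'_def using ls(1) by auto
  have "cmod (phi_series 0 (shift p last_iter) (of_real t))
     \<le> cmod (shift p last_iter (length ls' - 1)) * t ^ (length ls' - 1) / fact (length ls' - 1)"
  proof (rule phi_series_0_bound)
    show "annihilated_by ls' (shift p last_iter)"
      unfolding ls'_def last_iter_def by (intro annihilated_by_shift ls(3))
    show "ls' \<noteq> []" by (simp add: ls'_def)
    show "Re l \<le> 0" if "l \<in> set ls'" for l
      using that ls(2) dissipative_eigenvalue[OF sT_carrier dissT] by (auto simp: ls'_def)
    show "shift p last_iter k = 0" if "k + 1 < length ls'" for k
      using that last_iter_eq_0[of "k - p"] unfolding len by (auto simp: shift_def)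
    show "geometrically_bounded (shift p last_iter)"
      by (rule geometrically_bounded_shift[OF geometrically_bounded_last_iter])
  qed (rule t)
  also have "cmod (shift p last_iter (length ls' - 1)) = \<tau> * Re (krylov_gamma T)"
    unfolding len1 using tau_pos sigma_norm gamma_real
    by (simp add: shift_def last_iter_m norm_mult norm_power) (metis abs_of_pos norm_of_real)
  finally show ?thesis unfolding len1 .
qed

text \<open>
  Multiplied by \<open>t\<^sup>p\<close>, the error solves \<open>E' = M E + S M w\<close> with \<open>E(0) = 0\<close>, and integrating the bound
  on \<open>S\<close> once more raises the exponent to \<open>m + p + 1\<close>. Dividing by \<open>t\<^sup>p\<close> excludes \<open>t = 0\<close>, where the
  error is \<open>\<epsilon>\<^sub>0 / p! = 0\<close>.
\<close>

lemma error_bound: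
  assumes diss: "dissipative M" and t: "0 \<le> t"
  shows "vnorm2 (corrected_krylov_error p \<sigma> A v V T \<tau> w t) \<le>
    vnorm2 (A *\<^sub>v w) * \<tau> * Re (krylov_gamma T) * (t ^ (m + 1) / fact (m + p + 1))"
proof (cases "t = 0")
  case True
  have "corrected_krylov_error p \<sigma> A v V T \<tau> w t = 0\<^sub>v n"
    using error_carrier[of p t] True err_coeff_0
    by (intro eq_vecI) (auto simp: error_index phi_series_at_0)
  then show ?thesis using True by (simp add: vnorm2_eq_sqrt)
next
  case False
  define E where "E t = vec n (\<lambda>i. phi_series 0 (shift p (\<lambda>k. err_coeff k $ i)) (of_real t))" for t
  define S where "S t = phi_series 0 (shift p last_iter) (of_real t)" for t
  define c where "c = vnorm2 (A *\<^sub>v w) * (\<tau> * Re (krylov_gamma T))"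
  have Mw: "M *\<^sub>v w \<in> carrier_vec n" using A_carrier by (intro carrier_vecI) simp
  have norm_Mw: "vnorm2 (M *\<^sub>v w) = vnorm2 (A *\<^sub>v w)"
    unfolding smult_mat_mult_vec[OF A_carrier w_carrier] vnorm2_smult sigma_norm by simp
  have E_eq: "E t = (of_real t ^ p) \<cdot>\<^sub>v corrected_krylov_error p \<sigma> A v V T \<tau> w t" for t
    using error_carrier[of p t]
    by (intro eq_vecI) (auto simp: E_def error_index phi_series_0_shift geometrically_bounded_err_coeff)
  have "vnorm2 (E t) \<le> c * t ^ Suc (m + p) / fact (Suc (m + p))"
  proof (rule dissipative_ode_bound[OF M_carrier diss, where y = E and b = "\<lambda>t. S t \<cdot>\<^sub>v (M *\<^sub>v w)"
        and G = "\<lambda>t. c * t ^ Suc (m + p) / fact (Suc (m + p))"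
        and G' = "\<lambda>t. c * t ^ (m + p) / fact (m + p)"])
    show "((\<lambda>t. E t $ i) has_vector_derivative (M *\<^sub>v E t + S t \<cdot>\<^sub>v (M *\<^sub>v w)) $ i) (at t)"
      if i: "i < n" for t i
    proof -
      let ?e = "\<lambda>j. shift p (\<lambda>k. err_coeff k $ j)"
      have gb: "geometrically_bounded (?e j)" if "j < n" for j
        by (rule geometrically_bounded_shift[OF geometrically_bounded_err_coeff[OF that]])
      have gs: "geometrically_bounded (shift p last_iter)"
        by (rule geometrically_bounded_shift[OF geometrically_bounded_last_iter])
      (* For k = p - 1 the left-hand side is the coefficient err_coeff 0, which is zero. *)
      have step: "?e i (Suc k) = (\<Sum>j<n. M $$ (i, j) * ?e j k) + (M *\<^sub>v w) $ i * shift p last_iter k" for k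
      proof (cases "p \<le> k")
        case True
        then have "?e i (Suc k) = err_coeff (Suc (k - p)) $ i" by (simp add: shift_def Suc_diff_le)
        also have "\<dots> = (M *\<^sub>v err_coeff (k - p)) $ i + last_iter (k - p) * (M *\<^sub>v w) $ i"
          unfolding err_coeff_Suc using i A_carrier by (simp del: index_mult_mat_vec(1))
        also have "(M *\<^sub>v err_coeff (k - p)) $ i = (\<Sum>j<n. M $$ (i, j) * err_coeff (k - p) $ j)"
          by (rule mult_mat_vec_index_sum[OF M_carrier err_coeff_carrier i])
        finally show ?thesis using True by (simp add: shift_def mult.commute)
      next
        case False
        then have "?e i (Suc k) = 0" using i err_coeff_0 by (auto simp: shift_def)
        then show ?thesis using False by (simp add: shift_def)
      qed
      have "phi_series 0 (\<lambda>k. ?e i (Suc k)) (of_real t)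
          = (\<Sum>j<n. phi_series 0 (\<lambda>k. M $$ (i, j) * ?e j k) (of_real t))
            + phi_series 0 (\<lambda>k. (M *\<^sub>v w) $ i * shift p last_iter k) (of_real t)"
        unfolding step
        by (subst phi_series_add)
          (auto intro!: phi_series_sum geometrically_bounded_sum geometrically_bounded_cmult gb gs
            simp del: index_mult_mat_vec(1) index_smult_mat)
      also have "\<dots> = (\<Sum>j<n. M $$ (i, j) * E t $ j) + (M *\<^sub>v w) $ i * S t"
        unfolding E_def S_def using gb gs by (simp add: phi_series_cmult del: index_mult_mat_vec(1) index_smult_mat)
      also have "\<dots> = (M *\<^sub>v E t + S t \<cdot>\<^sub>v (M *\<^sub>v w)) $ i"
      proof -
        have "(M *\<^sub>v E t) $ i = (\<Sum>j<n. M $$ (i, j) * E t $ j)"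
          by (rule mult_mat_vec_index_sum[OF M_carrier _ i]) (simp add: E_def)
        then show ?thesis using i A_carrier by (simp add: mult.commute del: index_mult_mat_vec(1))
      qed
      finally have "phi_series 0 (\<lambda>k. ?e i (Suc k)) (of_real t) = (M *\<^sub>v E t + S t \<cdot>\<^sub>v (M *\<^sub>v w)) $ i" .
      then show ?thesis using phi_series_0_deriv[OF gb[OF i], of t] i by (simp only: E_def index_vec)
    qed
    show "((\<lambda>t. c * t ^ Suc (m + p) / fact (Suc (m + p))) has_real_derivative
        c * t ^ (m + p) / fact (m + p)) (at t)" for t
    proof -
      have "((\<lambda>t. c / fact (Suc (m + p)) * t ^ Suc (m + p)) has_real_derivative
          c / fact (Suc (m + p)) * (real (Suc (m + p)) * t ^ (Suc (m + p) - Suc 0))) (at t)"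
        by (intro DERIV_cmult DERIV_pow)
      then show ?thesis by (simp add: field_simps del: of_nat_Suc of_nat_add)
    qed
    show "vnorm2 (S t \<cdot>\<^sub>v (M *\<^sub>v w)) \<le> c * t ^ (m + p) / fact (m + p)" if "0 \<le> t" for t
      using mult_right_mono[OF last_iter_series_bound[OF diss that, of p] vnorm2_nonneg[of "A *\<^sub>v w"]]
      unfolding vnorm2_smult norm_Mw S_def c_def by (simp add: mult_ac)
    have "E 0 = 0\<^sub>v n"
      using err_coeff_0 by (intro eq_vecI) (auto simp: E_def phi_series_at_0 shift_def)
    then show "vnorm2 (E 0) \<le> c * 0 ^ Suc (m + p) / fact (Suc (m + p))"
      by (simp add: vnorm2_eq_sqrt)
  qed (use Mw t in \<open>auto simp: E_def\<close>)
  then have "t ^ p * vnorm2 (corrected_krylov_error p \<sigma> A v V T \<tau> w t)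
      \<le> t ^ p * (c * (t ^ (m + 1) / fact (m + p + 1)))"
    unfolding E_eq vnorm2_smult using t by (simp add: norm_power power_add mult_ac del: fact_Suc)
  then have "vnorm2 (corrected_krylov_error p \<sigma> A v V T \<tau> w t) \<le> c * (t ^ (m + 1) / fact (m + p + 1))"
    by (rule mult_left_le_imp_le) (use False t in auto)
  then show ?thesis unfolding c_def by (simp add: mult.assoc)
qed

end

theorem theorem3:
  fixes n m p :: nat
    and A V T :: "complex mat" and v w :: "complex vec"
    and \<sigma> :: complex and \<tau> :: real
  assumes "A \<in> carrier_mat n n"
    and "cmod \<sigma> = 1"
    and "v \<in> carrier_vec n"
    and "vnorm2 v = 1"
    and "m \<ge> 1"
    and "krylov_decomposition n m A v V T \<tau> w"
  defines "L \<equiv> corrected_krylov_error p \<sigma> A v V T \<tau> w"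
    and "\<gamma> \<equiv> krylov_gamma T"
  shows "(\<lambda>t::real. vnorm2 (L t -
            (complex_of_real \<tau> * \<gamma> * ((\<sigma> * complex_of_real t) ^ (m + 1) / fact (m + p + 1)))
              \<cdot>\<^sub>v (A *\<^sub>v w)))
          \<in> O[at_right 0](\<lambda>t. t ^ (m + 2))
       \<and> (lognorm2 (\<sigma> \<cdot>\<^sub>m A) \<le> 0 \<longrightarrow>
           (\<forall>t\<ge>0. vnorm2 (L t) \<le> vnorm2 (A *\<^sub>v w) * \<tau> * Re \<gamma> * (t ^ (m + 1) / fact (m + p + 1)))
         \<and> (\<lambda>t::real. vnorm2 (L t) -
              vnorm2 (A *\<^sub>v w) * \<tau> * Re \<gamma> * (t ^ (m + 1) / fact (m + p + 1)))
            \<in> O[at_right 0](\<lambda>t. t ^ (m + 2)))"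
proof -
  interpret krylov_decomposition n m A v V T \<tau> w by (rule assms(6))
  interpret scaled_krylov_decomposition n m A v V T \<tau> w \<sigma>
    using assms(1-3,5) by unfold_locales auto
  have 1: "(\<lambda>t. vnorm2 (L t - lead p t)) \<in> O[at_right 0](\<lambda>t. t ^ (m + 2))"
    unfolding L_def by (rule error_minus_lead)
  have "(\<lambda>t. vnorm2 (L t) - vnorm2 (A *\<^sub>v w) * \<tau> * Re \<gamma> * (t ^ (m + 1) / fact (m + p + 1)))
      \<in> O[at_right 0](\<lambda>t. vnorm2 (L t - lead p t))"
  proof (rule bigoI[where c = 1])
    show "\<forall>\<^sub>F t in at_right 0.
        norm (vnorm2 (L t) - vnorm2 (A *\<^sub>v w) * \<tau> * Re \<gamma> * (t ^ (m + 1) / fact (m + p + 1)))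
          \<le> 1 * norm (vnorm2 (L t - lead p t))"
      using eventually_at_right_less[of 0]
    proof eventually_elim
      case (elim t)
      have "dim_vec (L t) = dim_vec (lead p t)"
        using error_carrier[of p t] lead_carrier[of p t] unfolding L_def by simp
      then show ?case
        using vnorm2_diff_ge[of "L t" "lead p t"] vnorm2_lead[of t p] elim vnorm2_nonneg
        unfolding \<gamma>_def by simp
    qed
  qed
  from landau_o.big_trans[OF this 1]
  have 3: "(\<lambda>t. vnorm2 (L t) - vnorm2 (A *\<^sub>v w) * \<tau> * Re \<gamma> * (t ^ (m + 1) / fact (m + p + 1)))
      \<in> O[at_right 0](\<lambda>t. t ^ (m + 2))" .
  have 2: "\<forall>t\<ge>0. vnorm2 (L t) \<le> vnorm2 (A *\<^sub>v w) * \<tau> * Re \<gamma> * (t ^ (m + 1) / fact (m + p + 1))"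
    if "lognorm2 M \<le> 0"
    using error_bound dissipative_if_lognorm2_le_0[OF M_carrier that] unfolding L_def \<gamma>_def by blast
  show ?thesis using 1 2 3 unfolding lead_def \<gamma>_def by blast
qed

end
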